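(* Let $t:\Sigma^*\to\Omega^*$ be a rational (partial) function whose domain $X=\mathrm{dom}(t)$ is suffix-closed. If $X$ contains no linear fooling set for $t$ and $t(X)$ is bounded, then the $\overleftarrow{t}$-growth of $X$ is polynomial. Otherwise the $\overleftarrow{t}$-growth of $X$ is exponential.
   Context: A partial function $t:\Sigma^*\to\Omega^*$ is rational if its graph $\{(x,t(x))\}$ is a rational subset of the monoid $\Sigma^*\times\Omega^*$ (accepted by a finite transducer). A language is suffix-closed if it contains all suffixes of its words. For a partial function $t$ with suffix-closed domain, its suffix expansion $\overleftarrow{t}:\mathrm{dom}(t)\to(\Omega^* )^*$ maps $a_1\cdots a_n$ to the finite sequence $(t(a_1\cdots a_n),t(a_2\cdots a_n),\dots,t(a_n))$. For a partial function $f:\Sigma^*\to Y$ and $X\subseteq\mathrm{dom}(f)$, the $f$-growth of $X$ is $\gamma(n)=|f(X\cap\Sigma^{\le n})|$. A function $\gamma:\mathbb N\to\mathbb N$ grows polynomially if $\gamma(n)\in O(n^k)$ for some $k$, and exponentially if there is $c>1$ with $\gamma(n)\ge c^n$ for infinitely many $n$. A language $K$ is bounded if $K\subseteq w_1^*\cdots w_k^*$ for some words $w_1,\dots,w_k$. A linear fooling scheme for $t$ is a tuple $(u_2,v_2,u,v,Z)$ with $u_2,v_2,u,v\in\Sigma^*$, $Z\subseteq\Sigma^*$, such that $u_2$ is a suffix of $u$, $v_2$ is a suffix of $v$, $|u_2|=|v_2|$, $\{u_2,v_2\}\{u,v\}^*Z\subseteq\mathrm{dom}(t)$, and there is a constant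 $c$ such that for every $n\in\mathbb N$ there exists $z_n\in Z$ with $|z_n|\le cn$ (for all large $n$, i.e. $|z_n|\in O(n)$) and $t(u_2wz_n)\neq t(v_2wz_n)$ for all $w\in\{u,v\}^{\le n}$. The set $\{u_2,v_2\}\{u,v\}^*Z$ is then called a linear fooling set for $t$; "$X$ contains a linear fooling set for $t$" means some linear fooling set for $t$ is a subset of $X$. *)

theory Defs
  imports Main "HOL-Library.Sublist" "HOL-Library.Landau_Symbols"
begin

definition pmult :: "'a list \<times> 'b list \<Rightarrow> 'a list \<times> 'b list \<Rightarrow> 'a list \<times> 'b list" where
  "pmult p q = (fst p @ fst q, snd p @ snd q)"

definition pset_mult :: "('a list \<times> 'b list) set \<Rightarrow> ('a list \<times> 'b list) set \<Rightarrow> ('a list \<times> 'b list) set" where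
  "pset_mult A B = {pmult a b | a b. a \<in> A \<and> b \<in> B}"

inductive_set pstar :: "('a list \<times> 'b list) set \<Rightarrow> ('a list \<times> 'b list) set"
  for A :: "('a list \<times> 'b list) set" where
  pstar_unit: "([], []) \<in> pstar A"
| pstar_step: "a \<in> A \<Longrightarrow> s \<in> pstar A \<Longrightarrow> pmult a s \<in> pstar A"

inductive_set rational_sets :: "('a list \<times> 'b list) set set" where
  rat_finite: "finite A \<Longrightarrow> A \<in> rational_sets"
| rat_union: "A \<in> rational_sets \<Longrightarrow> B \<in> rational_sets \<Longrightarrow> A \<union> B \<in> rational_sets"
| rat_mult: "A \<in> rational_sets \<Longrightarrow> B \<in> rational_sets \<Longrightarrow> pset_mult A B \<in> rational_sets"
| rat_star: "A \<in> rational_sets \<Longrightarrow> pstar A \<in> rational_sets"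

definition graph :: "('a list \<rightharpoonup> 'b list) \<Rightarrow> ('a list \<times> 'b list) set" where
  "graph t = {(x, y). t x = Some y}"

definition rational_fun :: "('a list \<rightharpoonup> 'b list) \<Rightarrow> bool" where
  "rational_fun t \<longleftrightarrow> graph t \<in> rational_sets"

definition suffix_closed :: "'a list set \<Rightarrow> bool" where
  "suffix_closed L \<longleftrightarrow> (\<forall>w \<in> L. \<forall>s. suffix s w \<longrightarrow> s \<in> L)"

definition suffix_expansion :: "('a list \<rightharpoonup> 'b list) \<Rightarrow> ('a list \<rightharpoonup> 'b list list)" where
  "suffix_expansion t w =
     (if w \<in> dom t then Some (map (\<lambda>i. the (t (drop i w))) [0..<length w]) else None)"

definition growth :: "('a list \<rightharpoonup> 'c) \<Rightarrow> 'a list set \<Rightarrow> nat \<Rightarrow> nat" where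
  "growth f X n = card ((\<lambda>x. the (f x)) ` {x \<in> X. length x \<le> n})"

definition grows_polynomially :: "(nat \<Rightarrow> nat) \<Rightarrow> bool" where
  "grows_polynomially \<gamma> \<longleftrightarrow> (\<exists>k::nat. (\<lambda>n. real (\<gamma> n)) \<in> O(\<lambda>n. real n ^ k))"

definition grows_exponentially :: "(nat \<Rightarrow> nat) \<Rightarrow> bool" where
  "grows_exponentially \<gamma> \<longleftrightarrow> (\<exists>c::real. c > 1 \<and> (\<exists>\<^sub>\<infinity>n. real (\<gamma> n) \<ge> c ^ n))"

definition lang_mult :: "'a list set \<Rightarrow> 'a list set \<Rightarrow> 'a list set" where
  "lang_mult A B = {x @ y | x y. x \<in> A \<and> y \<in> B}"

definition word_star :: "'a list \<Rightarrow> 'a list set" where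
  "word_star w = {concat (replicate i w) | i. True}"

fun lang_prod :: "'a list set list \<Rightarrow> 'a list set" where
  "lang_prod [] = {[]}"
| "lang_prod (L # Ls) = lang_mult L (lang_prod Ls)"

definition bounded_lang :: "'a list set \<Rightarrow> bool" where
  "bounded_lang K \<longleftrightarrow> (\<exists>ws. K \<subseteq> lang_prod (map word_star ws))"

definition lang_star :: "'a list set \<Rightarrow> 'a list set" where
  "lang_star A = concat ` {ws. set ws \<subseteq> A}"

definition lang_power_le :: "'a list set \<Rightarrow> nat \<Rightarrow> 'a list set" where
  "lang_power_le A n = concat ` {ws. set ws \<subseteq> A \<and> length ws \<le> n}"

definition fooling_set :: "'a list \<Rightarrow> 'a list \<Rightarrow> 'a list \<Rightarrow> 'a list \<Rightarrow> 'a list set \<Rightarrow> 'a list set" where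
  "fooling_set u2 v2 u v Z = lang_mult (lang_mult {u2, v2} (lang_star {u, v})) Z"

definition linear_fooling_scheme ::
  "('a list \<rightharpoonup> 'b list) \<Rightarrow> 'a list \<Rightarrow> 'a list \<Rightarrow> 'a list \<Rightarrow> 'a list \<Rightarrow> 'a list set \<Rightarrow> bool" where
  "linear_fooling_scheme t u2 v2 u v Z \<longleftrightarrow>
     suffix u2 u \<and> suffix v2 v \<and> length u2 = length v2 \<and>
     fooling_set u2 v2 u v Z \<subseteq> dom t \<and>
     (\<exists>c::nat. \<exists>N::nat. \<forall>n. \<exists>z \<in> Z. (n \<ge> N \<longrightarrow> length z \<le> c * n) \<and>
        (\<forall>w \<in> lang_power_le {u, v} n. t (u2 @ w @ z) \<noteq> t (v2 @ w @ z)))"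

definition contains_linear_fooling_set :: "('a list \<rightharpoonup> 'b list) \<Rightarrow> 'a list set \<Rightarrow> bool" where
  "contains_linear_fooling_set t X \<longleftrightarrow>
     (\<exists>u2 v2 u v Z. linear_fooling_scheme t u2 v2 u v Z \<and> fooling_set u2 v2 u v Z \<subseteq> X)"

end

(*
Extending words to the left, a rational function is computed by a finite family of residual
relations: the states of a transducer in which accessible states have functional residuals. If the
outputs of two loops at an accessible state do not commute, then t(X) is unbounded and has
exponentially many values on short words; if all such loops commute, cutting runs at the last
visits of states shows that t(X) is bounded. A linear fooling scheme yields exponential growth since
any two different words in {u, v}^n z_n have suffixes u2 w z_n and v2 w z_n.

Conversely, let t(X) be bounded and let there be no linear fooling set. Map a word x to the relation
phi x of state pairs connected by a run on x. If y, y', e, e' all have the same idempotent value,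
then t(s e e' z) = t(s' e e' z) for suffixes s of y and s' of y' of equal length: both runs reach
loops whose outputs commute, and a difference could be pumped to a linear fooling set. Hence, over a
context e e' z, the block y contributes nothing to the suffix expansion but its length. By a variant of
Simon's factorization forest theorem, the set of all words arises from finite languages by unions,
products, subsets and stars of languages with one idempotent value, and all of these
operations preserve a polynomial number of suffix expansions.
*)

theory Submission
  imports Defs "HOL-Library.Infinite_Set" "HOL-Library.FuncSet"
begin

section \<open>Words\<close>

text \<open>The transducer is replaced by a finite family of relations closed under residuals, so a
  state is a set of pairs and its functionality is a property of that set. The obstacle in counting
  is that separate expansions of \<open>x\<close> and \<open>y\<close> do not give the suffix
  expansion of \<open>x @ y\<close>: the values on suffixes beginning inside \<open>x\<close> also
  read \<open>y\<close>. Everything is therefore counted over a right context \<open>z\<close>, and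
  each expansion carries the function sending \<open>w\<close> to \<open>t (w @ x @ z)\<close>,
  which is all that letters further to the left can see. Only polynomially many such functions occur
  because outputs have linear length and become, after a fixed prefix, members of the bounded set of
  values of \<open>t\<close>. A context contains two idempotent blocks \<open>e\<close> and
  \<open>e'\<close> because a run over a single block passes its looping state at an unknown
  position; over \<open>e @ e'\<close> the run can be chosen to do so exactly at the border, and
  pumped words are inserted there.\<close>

lemma finite_words_le: "finite {x :: 'a::finite list. length x \<le> n}"
  using finite_lists_length_le[of "UNIV :: 'a set" n] by simp

lemma length_concat_le:
  assumes "\<And>x. x \<in> set ws \<Longrightarrow> length x \<le> L"
  shows "length (concat ws) \<le> length ws * L"
  using assms by (induction ws) (auto intro: add_mono)

lemma length_concat_map_le:
  assumes "\<And>x. x \<in> set ws \<Longrightarrow> length (f x) \<le> L"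
  shows "length (concat (map f ws)) \<le> length ws * L"
  using length_concat_le[of "map f ws" L] assms by auto

text \<open>Used for lists of blocks: behind the rightmost mismatch both lists continue with the
  same \<open>s\<close>, which is the situation a fooling scheme speaks about.\<close>

lemma same_length_suffix_split:
  assumes "xs \<noteq> ys" "length xs = length ys"
  obtains p x q y s where "xs = p @ x # s" "ys = q @ y # s" "x \<noteq> y"
proof -
  have "\<exists>p x q y s. xs = p @ x # s \<and> ys = q @ y # s \<and> x \<noteq> y"
    using assms
  proof (induction xs arbitrary: ys)
    case Nil
    then show ?case by simp
  next
    case (Cons a xs)
    then obtain b ys' where ys: "ys = b # ys'" "length xs = length ys'"
      by (cases ys) auto
    show ?case
    proof (cases "xs = ys'")
      case True
      then show ?thesis
        using Cons.prems ys by (metis append_Nil)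
    next
      case False
      then obtain p x q y s where "xs = p @ x # s" "ys' = q @ y # s" "x \<noteq> y"
        using Cons.IH ys by blast
      then show ?thesis
        unfolding ys by (metis append_Cons)
    qed
  qed
  then show thesis
    using that by blast
qed

text \<open>Primitive roots are avoided: \<open>c\<close> is stripped from the front of
  \<open>y\<close> while it fits, and what remains is a prefix of \<open>c\<close>.\<close>

lemma commute_prefix:
  assumes "c @ y = y @ c" "c \<noteq> []"
  shows "\<exists>k p. y = concat (replicate k c) @ p \<and> prefix p c"
  using assms(1)
proof (induction "length y" arbitrary: y rule: less_induct)
  case less
  show ?case
  proof (cases "length c \<le> length y")
    case True
    then obtain y' where y: "y = c @ y'"
      by (metis less.prems append_eq_append_conv_if append_eq_conv_conj)
    then have "c @ y' = y' @ c" "length y' < length y"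
      using less.prems assms(2) by auto
    then obtain k p where "y' = concat (replicate k c) @ p" "prefix p c"
      using less.hyps by blast
    then have "y = concat (replicate (Suc k) c) @ p"
      using y by simp
    then show ?thesis
      using \<open>prefix p c\<close> by blast
  next
    case False
    then have "prefix y c"
      by (metis less.prems nat_le_linear prefixI prefix_length_prefix)
    then show ?thesis
      by (metis append_Nil concat.simps(1) replicate_0)
  qed
qed

text \<open>The two blocks differ but have the same length, so block borders lie at fixed positions
  and a concatenation determines its blocks.\<close>

lemma card_commuting_products:
  assumes "x @ y \<noteq> y @ x"
  shows "inj_on concat {ws. set ws \<subseteq> {x @ y, y @ x} \<and> length ws = m}"
    and "card {ws. set ws \<subseteq> {x @ y, y @ x} \<and> length ws = m} = 2 ^ m"
proof -
  show "inj_on concat {ws. set ws \<subseteq> {x @ y, y @ x} \<and> length ws = m}"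
  proof (rule inj_onI)
    fix vs ws
    assume "vs \<in> {ws. set ws \<subseteq> {x @ y, y @ x} \<and> length ws = m}"
      "ws \<in> {ws. set ws \<subseteq> {x @ y, y @ x} \<and> length ws = m}" and eq: "concat vs = concat ws"
    then have *: "length vs = length ws" "set vs \<subseteq> {x @ y, y @ x}" "set ws \<subseteq> {x @ y, y @ x}"
      by auto
    have "\<forall>(a, b) \<in> set (zip vs ws). length a = length b"
    proof (clarify)
      fix a b assume "(a, b) \<in> set (zip vs ws)"
      then have "a \<in> set vs" "b \<in> set ws"
        by (auto dest: set_zip_leftD set_zip_rightD)
      then show "length a = length b"
        using *(2,3) by (auto dest!: subsetD)
    qed
    then show "vs = ws"
      using concat_injective[of vs ws] eq *(1) by simp
  qed
  have "card {x @ y, y @ x} = 2"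
    using assms by simp
  then show "card {ws. set ws \<subseteq> {x @ y, y @ x} \<and> length ws = m} = 2 ^ m"
    using card_lists_length_eq[of "{x @ y, y @ x}" m] by simp
qed

section \<open>Growth\<close>

lemma grows_exponentiallyI:
  assumes "C \<ge> 1" and "\<And>m. m \<ge> N \<Longrightarrow> \<gamma> (C * m) \<ge> 2 ^ m"
  shows "grows_exponentially \<gamma>"
proof -
  \<comment> \<open>The C-th root of 2 turns the bound \<open>2 ^ m\<close> at length
    \<open>C * m\<close> into \<open>c ^ (C * m)\<close>.\<close>
  define c where "c = (2::real) powr (1 / real C)"
  have "c > 1"
    unfolding c_def using assms(1) by simp
  have "real (\<gamma> (C * m)) \<ge> c ^ (C * m)" if "m \<ge> N" for m
  proof -
    have "c ^ (C * m) = 2 ^ m"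
      unfolding c_def using assms(1)
      by (simp add: powr_powr powr_realpow [symmetric])
    then show ?thesis
      using assms(2)[OF that] by (metis of_nat_le_iff of_nat_numeral of_nat_power)
  qed
  moreover have "\<exists>m\<ge>N. C * m > k" for k
  proof (intro exI[of _ "N + Suc k"] conjI)
    have "1 * (N + Suc k) \<le> C * (N + Suc k)"
      using assms(1) by (intro mult_right_mono) auto
    then show "k < C * (N + Suc k)"
      by (rule less_le_trans[rotated]) simp
  qed simp
  ultimately have "\<exists>\<^sub>\<infinity>n. real (\<gamma> n) \<ge> c ^ n"
    unfolding INFM_nat by blast
  then show ?thesis
    unfolding grows_exponentially_def using \<open>c > 1\<close> by blast
qed

lemma grows_polynomiallyI:
  assumes "\<And>n. \<gamma> n \<le> (n + 2) ^ k"
  shows "grows_polynomially \<gamma>"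
proof -
  have "(\<lambda>n. real (\<gamma> n)) \<in> O(\<lambda>n. real n ^ k)"
  proof (rule bigoI[of _ "3 ^ k"], rule eventually_sequentiallyI[of 1])
    fix n :: nat assume "1 \<le> n"
    have "\<gamma> n \<le> (3 * n) ^ k"
      using assms[of n] power_mono[of "n + 2" "3 * n" k] \<open>1 \<le> n\<close> by simp
    then have "real (\<gamma> n) \<le> real ((3 * n) ^ k)"
      using of_nat_le_iff by blast
    then show "norm (real (\<gamma> n)) \<le> 3 ^ k * norm (real n ^ k)"
      by (simp add: power_mult_distrib)
  qed
  then show ?thesis
    unfolding grows_polynomially_def by blast
qed

text \<open>The base \<open>n + 2\<close> is at least 2 for every n, so constant factors and
  summands are absorbed into the exponent and no coefficient or threshold is carried along.\<close>

definition poly_bound :: "(nat \<Rightarrow> nat) \<Rightarrow> bool" where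
  "poly_bound f \<longleftrightarrow> (\<exists>k. \<forall>n. f n \<le> (n + 2) ^ k)"

lemma poly_bound_mono: "poly_bound g \<Longrightarrow> (\<And>n. f n \<le> g n) \<Longrightarrow> poly_bound f"
  unfolding poly_bound_def by (meson order_trans)

lemma poly_bound_linear: "poly_bound (\<lambda>n. c * n + d)"
proof -
  have "c * n + d \<le> (n + 2) ^ (c + d + 1)" for n
  proof -
    have "c * n + d \<le> (c + d) * (n + 2)"
      by (simp add: algebra_simps)
    also have "\<dots> \<le> 2 ^ (c + d) * (n + 2)"
      by (intro mult_right_mono) (auto intro: less_imp_le[OF less_exp])
    also have "\<dots> \<le> (n + 2) ^ (c + d) * (n + 2)"
      by (intro mult_right_mono power_mono) auto
    finally show ?thesis by (simp add: mult.commute)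
  qed
  then show ?thesis
    unfolding poly_bound_def by blast
qed

lemma poly_bound_const: "poly_bound (\<lambda>n. d)"
  using poly_bound_linear[of 0 d] by simp

lemma poly_bound_mult:
  assumes "poly_bound f" "poly_bound g"
  shows "poly_bound (\<lambda>n. f n * g n)"
proof -
  obtain k l where "\<forall>n. f n \<le> (n + 2) ^ k" "\<forall>n. g n \<le> (n + 2) ^ l"
    using assms unfolding poly_bound_def by blast
  then have "\<forall>n. f n * g n \<le> (n + 2) ^ (k + l)"
    by (simp add: power_add mult_mono)
  then show ?thesis
    unfolding poly_bound_def by blast
qed

lemma poly_bound_power: "poly_bound f \<Longrightarrow> poly_bound (\<lambda>n. f n ^ j)"
  by (induction j) (auto intro: poly_bound_const poly_bound_mult)

text \<open>The sum is at most \<open>(f n + 1) * (g n + 1)\<close>, which reduces addition to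
  adding 1.\<close>

lemma poly_bound_add:
  assumes "poly_bound f" "poly_bound g"
  shows "poly_bound (\<lambda>n. f n + g n)"
proof -
  have "poly_bound (\<lambda>n. h n + 1)" if h: "poly_bound h" for h
  proof -
    obtain k where k: "\<forall>n. h n \<le> (n + 2) ^ k"
      using h unfolding poly_bound_def by blast
    have "h n + 1 \<le> (n + 2) ^ (k + 1)" for n
    proof -
      have "h n + 1 \<le> (n + 2) ^ k + (n + 2) ^ k"
        by (rule add_mono[OF k[rule_format]]) simp
      also have "\<dots> \<le> (n + 2) ^ (k + 1)"
        by simp
      finally show ?thesis .
    qed
    then show ?thesis
      unfolding poly_bound_def by blast
  qed
  then have "poly_bound (\<lambda>n. (f n + 1) * (g n + 1))"
    using assms by (intro poly_bound_mult)
  then show ?thesis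
    by (rule poly_bound_mono) (simp add: algebra_simps)
qed

lemma poly_bound_comp_linear:
  assumes "poly_bound f"
  shows "poly_bound (\<lambda>n. f (c * n + d))"
proof -
  obtain k where k: "\<forall>n. f n \<le> (n + 2) ^ k"
    using assms unfolding poly_bound_def by blast
  have "poly_bound (\<lambda>n. (c * n + (d + 2)) ^ k)"
    by (intro poly_bound_power poly_bound_linear)
  then show ?thesis
    by (rule poly_bound_mono) (use k in \<open>simp add: add.assoc\<close>)
qed

lemma not_poly_bound_exp: "\<not> poly_bound (\<lambda>n. 2 ^ n)"
proof
  assume "poly_bound (\<lambda>n. 2 ^ n)"
  then obtain k where k: "\<And>n. (2::nat) ^ n \<le> (n + 2) ^ k"
    unfolding poly_bound_def by blast
  \<comment> \<open>The bound is tested at \<open>q = 2 ^ m - 2\<close>, where the base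
    \<open>q + 2\<close> is a power of 2 and only the exponents q and \<open>m * k\<close> are
    compared. The choice of j makes the square of \<open>j + 1\<close>, a lower bound for
    \<open>2 ^ m\<close>, exceed \<open>m * k + 2\<close>.\<close>
  define j where "j = 2 * k + 2"
  define m where "m = 2 * j"
  have "j + 1 \<le> 2 ^ j"
    using less_exp[of j] by (simp add: Suc_le_eq)
  then have "(j + 1) * (j + 1) \<le> 2 ^ m"
    unfolding m_def mult_2 power_add by (intro mult_mono) auto
  moreover have "m * k + 2 < (j + 1) * (j + 1)"
    unfolding m_def j_def by (simp add: algebra_simps)
  ultimately have "m * k + 2 < 2 ^ m"
    by linarith
  moreover define q where "q = (2::nat) ^ m - 2"
  ultimately have q: "q + 2 = 2 ^ m" "m * k < q"
    by linarith+
  have "(2::nat) ^ q \<le> 2 ^ (m * k)"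
    using k[of q] unfolding q(1) by (simp only: power_mult)
  then have "q \<le> m * k"
    by (rule power_le_imp_le_exp[rotated]) simp
  then show False
    using q(2) by linarith
qed

section \<open>Counting values through a determining invariant\<close>

lemma card_image_le_of_determines:
  assumes "finite (g ` S)" "\<And>x y. x \<in> S \<Longrightarrow> y \<in> S \<Longrightarrow> g x = g y \<Longrightarrow> f x = f y"
  shows "finite (f ` S)" "card (f ` S) \<le> card (g ` S)"
proof -
  have "f x = f (SOME y. y \<in> S \<and> g y = g x)" if "x \<in> S" for x
  proof -
    have "(SOME y. y \<in> S \<and> g y = g x) \<in> S \<and> g (SOME y. y \<in> S \<and> g y = g x) = g x"
      by (rule someI[of "\<lambda>y. y \<in> S \<and> g y = g x" x]) (simp add: that)
    then show ?thesis
      using assms(2)[OF that] by (metis (no_types, lifting))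
  qed
  then have "f ` S = (\<lambda>v. f (SOME y. y \<in> S \<and> g y = v)) ` g ` S"
    unfolding image_image by (rule image_cong[OF refl])
  then show "finite (f ` S)" "card (f ` S) \<le> card (g ` S)"
    using finite_imageI[OF assms(1)] card_image_le[OF assms(1)] by simp_all
qed

lemma card_subset_UN_le:
  assumes "finite A" "S \<subseteq> (\<Union>j\<in>A. F j)" "\<And>j. j \<in> A \<Longrightarrow> finite (F j)"
    "card A \<le> a" "\<And>j. j \<in> A \<Longrightarrow> card (F j) \<le> b"
  shows "card S \<le> a * b"
proof -
  have "card S \<le> card (\<Union>j\<in>A. F j)"
    using assms by (intro card_mono) auto
  also have "\<dots> \<le> (\<Sum>j\<in>A. card (F j))"
    using assms(1) by (rule card_UN_le)
  also have "\<dots> \<le> card A * b"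
    using sum_bounded_above[of A "\<lambda>j. card (F j)" b] assms(5) by simp
  also have "\<dots> \<le> a * b"
    using assms(4) by simp
  finally show ?thesis .
qed

section \<open>Rational relations have finitely many residuals\<close>

text \<open>The relations themselves are the states: a transition reads \<open>a\<close> and writes
  \<open>k\<close>, and it only has to be sound, hence an inclusion in place of equality with a
  residual.\<close>

definition step :: "('a list \<times> 'b list) set \<Rightarrow> 'a \<Rightarrow> 'b list \<Rightarrow> ('a list \<times> 'b list) set \<Rightarrow> bool" where
  "step S a k S' \<longleftrightarrow> (\<forall>(w, y) \<in> S'. (a # w, k @ y) \<in> S)"

text \<open>Completeness: each pair with nonempty input is covered by a transition inside the
  family. Pairs with empty input are final outputs, so no transition without an input letter is
  required.\<close>

definition residual_closed :: "('a list \<times> 'b list) set set \<Rightarrow> bool" where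
  "residual_closed F \<longleftrightarrow>
     (\<forall>S\<in>F. \<forall>a w y. (a # w, y) \<in> S \<longrightarrow>
        (\<exists>S'\<in>F. \<exists>k y'. step S a k S' \<and> y = k @ y' \<and> (w, y') \<in> S'))"

lemma residual_closedI:
  assumes "\<And>S a w y. S \<in> F \<Longrightarrow> (a # w, y) \<in> S \<Longrightarrow>
    \<exists>S'\<in>F. \<exists>k y'. step S a k S' \<and> y = k @ y' \<and> (w, y') \<in> S'"
  shows "residual_closed F"
  using assms unfolding residual_closed_def by blast

lemma residual_closedE:
  assumes "residual_closed F" "S \<in> F" "(a # w, y) \<in> S"
  obtains S' k y' where "S' \<in> F" "step S a k S'" "y = k @ y'" "(w, y') \<in> S'"
  using assms unfolding residual_closed_def by blast

lemma step_mono: "step S a k S' \<Longrightarrow> S \<subseteq> T \<Longrightarrow> step T a k S'"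
  unfolding step_def by blast

lemma pset_multI:
  "(x, y) \<in> A \<Longrightarrow> (x', y') \<in> B \<Longrightarrow> (x @ x', y @ y') \<in> pset_mult A B"
  unfolding pset_mult_def pmult_def by force

lemma pset_multE:
  assumes "(x, y) \<in> pset_mult A B"
  obtains x1 y1 x2 y2 where "(x1, y1) \<in> A" "(x2, y2) \<in> B" "x = x1 @ x2" "y = y1 @ y2"
  using assms unfolding pset_mult_def pmult_def by force

lemma step_pset_mult_left:
  assumes "step S a k S'"
  shows "step (pset_mult S B) a k (pset_mult S' B)"
proof -
  have "(a # w, k @ y) \<in> pset_mult S B" if "(w, y) \<in> pset_mult S' B" for w y
  proof -
    obtain w1 y1 w2 y2 where *: "(w1, y1) \<in> S'" "(w2, y2) \<in> B" "w = w1 @ w2" "y = y1 @ y2"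
      using \<open>(w, y) \<in> pset_mult S' B\<close> by (rule pset_multE)
    then have "(a # w1, k @ y1) \<in> S"
      using assms unfolding step_def by blast
    from pset_multI[OF this *(2)] show ?thesis
      using * by simp
  qed
  then show ?thesis
    unfolding step_def by blast
qed

lemma step_pset_mult_right:
  assumes "([], y0) \<in> S" "step B a k B'"
  shows "step (pset_mult S B) a (y0 @ k) B'"
  using assms pset_multI[OF assms(1)] unfolding step_def by fastforce

text \<open>Either the left factor reads the letter \<open>a\<close>, or it reads nothing and only
  prepends an output \<open>y0\<close>.\<close>

lemma pset_mult_cases:
  assumes F: "residual_closed F" "S \<in> F" and "(a # w, y) \<in> pset_mult S B"
  shows "(\<exists>S'\<in>F. \<exists>k y'. step (pset_mult S B) a k (pset_mult S' B) \<and> y = k @ y' \<and> (w, y') \<in> pset_mult S' B)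
     \<or> (\<exists>y0 y'. ([], y0) \<in> S \<and> (a # w, y') \<in> B \<and> y = y0 @ y')"
proof -
  obtain x1 y1 x2 y2 where *: "(x1, y1) \<in> S" "(x2, y2) \<in> B" "a # w = x1 @ x2" "y = y1 @ y2"
    using assms(3) by (rule pset_multE)
  show ?thesis
  proof (cases x1)
    case Nil
    then show ?thesis using * by auto
  next
    case (Cons b x1')
    then have "b = a" "w = x1' @ x2"
      using * by auto
    then obtain S' k y' where S': "S' \<in> F" "step S a k S'" "y1 = k @ y'" "(x1', y') \<in> S'"
      using residual_closedE[OF F] * Cons by metis
    have "(w, y' @ y2) \<in> pset_mult S' B"
      using pset_multI[OF S'(4) *(2)] \<open>w = x1' @ x2\<close> by simp
    moreover have "y = k @ (y' @ y2)"
      using * S' by simp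
    ultimately show ?thesis
      using step_pset_mult_left[OF S'(2)] S'(1) by blast
  qed
qed

lemma pstar_append:
  assumes "s \<in> pstar A" "r \<in> pstar A"
  shows "pmult s r \<in> pstar A"
  using assms
proof (induction rule: pstar.induct)
  case pstar_unit
  then show ?case by (simp add: pmult_def)
next
  case (pstar_step a s)
  then have "pmult a (pmult s r) \<in> pstar A"
    by (simp add: pstar.pstar_step)
  then show ?case by (simp add: pmult_def)
qed

lemma pset_mult_pstar_subset: "pset_mult A (pstar A) \<subseteq> pstar A"
  unfolding pset_mult_def by (auto intro: pstar.pstar_step)

text \<open>The factors before the first one with nonempty input only write; there may be
  arbitrarily many, and their outputs are gathered in the single word \<open>y0\<close>.\<close>

lemma pstar_Cons:
  assumes "s \<in> pstar A" "fst s = a # w"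
  shows "\<exists>y0 x1 y1 x2 y2. ([], y0) \<in> pstar A \<and> (a # x1, y1) \<in> A \<and> (x2, y2) \<in> pstar A
    \<and> w = x1 @ x2 \<and> snd s = y0 @ y1 @ y2"
  using assms
proof (induction rule: pstar.induct)
  case pstar_unit
  then show ?case by simp
next
  case (pstar_step p s)
  obtain x1 y1 where p: "p = (x1, y1)" by fastforce
  show ?case
  proof (cases x1)
    case Nil
    then have "fst s = a # w"
      using pstar_step.prems p by (simp add: pmult_def)
    then obtain y0 z1 u1 z2 u2 where *: "([], y0) \<in> pstar A" "(a # z1, u1) \<in> A" "(z2, u2) \<in> pstar A"
      "w = z1 @ z2" "snd s = y0 @ u1 @ u2"
      using pstar_step.IH by blast
    moreover have "([], y1 @ y0) \<in> pstar A"
      using pstar.pstar_step[of p A "([], y0)"] pstar_step.hyps p Nil *(1)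
      by (simp add: pmult_def)
    moreover have "snd (pmult p s) = (y1 @ y0) @ u1 @ u2"
      using * p by (simp add: pmult_def)
    ultimately show ?thesis
      by blast
  next
    case (Cons b x1')
    then have "(a # x1', y1) \<in> A" "w = x1' @ fst s" "snd (pmult p s) = [] @ y1 @ snd s"
      using pstar_step p by (auto simp: pmult_def)
    moreover have "(fst s, snd s) \<in> pstar A"
      using pstar_step.hyps by simp
    ultimately show ?thesis
      using pstar.pstar_unit[of A] by blast
  qed
qed

text \<open>Kleene's construction with relations as states. A union needs one new relation, which
  inherits transitions by monotonicity of \<open>step\<close>; in products and stars the residuals
  are residuals of a factor, multiplied by what follows.\<close>

lemma finite_residual_family:
  assumes "R \<in> rational_sets"
  shows "\<exists>F. finite F \<and> residual_closed F \<and> R \<in> F"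
  using assms
proof (induction rule: rational_sets.induct)
  case (rat_finite A)
  then show ?case
  proof (induction rule: finite_induct)
    case empty
    have "residual_closed {{} :: ('a list \<times> 'b list) set}"
      by (rule residual_closedI) auto
    then show ?case by (intro exI[of _ "{{}}"]) auto
  next
    case (insert p A)
    obtain x y where p: "p = (x, y)" by fastforce
    \<comment> \<open>Reading letters of x writes nothing; the whole output y is kept until the end
      of the input.\<close>
    define P where "P = (\<lambda>x'. {(x', y)}) ` {x'. suffix x' x}"
    have P: "finite P" "{p} \<in> P"
      unfolding P_def p by (auto simp: set_suffixes_eq[symmetric])
    have step_P: "\<exists>S'\<in>P. \<exists>k y''. step S a k S' \<and> y' = k @ y'' \<and> (w, y'') \<in> S'"
      if "S \<in> P" "(a # w, y') \<in> S" for S a w y'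
    proof -
      have S: "S = {(a # w, y)}" "y' = y" "suffix (a # w) x"
        using that unfolding P_def by auto
      then have "{(w, y)} \<in> P"
        unfolding P_def by (auto dest: suffix_ConsD)
      moreover have "step S a [] {(w, y)}"
        unfolding S step_def by simp
      ultimately show ?thesis
        using S by force
    qed
    obtain F where F: "finite F" "residual_closed F" "A \<in> F"
      using insert by blast
    let ?F = "F \<union> P \<union> {insert p A}"
    have "residual_closed ?F"
    proof (rule residual_closedI)
      fix S a w y' assume S: "S \<in> ?F" "(a # w, y') \<in> S"
      consider "S \<in> F" | "S \<in> P" | "S = insert p A" "(a # w, y') \<in> A" | "S = insert p A" "(a # w, y') \<in> {p}"
        using S by blast
      then show "\<exists>S'\<in>?F. \<exists>k y''. step S a k S' \<and> y' = k @ y'' \<and> (w, y'') \<in> S'"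
      proof cases
        case 1
        then show ?thesis using residual_closedE[OF F(2) _ S(2)] by (metis UnI1)
      next
        case 2
        then show ?thesis using step_P S(2) by blast
      next
        case 3
        then obtain S' k y'' where "S' \<in> F" "step A a k S'" "y' = k @ y''" "(w, y'') \<in> S'"
          using residual_closedE[OF F(2,3)] by metis
        then show ?thesis using step_mono[of A a k S' S] 3 by blast
      next
        case 4
        then obtain S' k y'' where "S' \<in> P" "step {p} a k S'" "y' = k @ y''" "(w, y'') \<in> S'"
          using step_P P(2) by metis
        then show ?thesis using step_mono[of "{p}" a k S' S] 4 by blast
      qed
    qed
    then show ?case
      using F(1) P(1) by (intro exI[of _ ?F]) simp
  qed
next
  case (rat_union A B)
  then obtain F G where F: "finite F" "residual_closed F" "A \<in> F"
    and G: "finite G" "residual_closed G" "B \<in> G" by blast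
  let ?F = "F \<union> G \<union> {A \<union> B}"
  have "residual_closed ?F"
  proof (rule residual_closedI)
    fix S a w y assume S: "S \<in> ?F" "(a # w, y) \<in> S"
    consider T where "T \<in> F" "T \<subseteq> S" "(a # w, y) \<in> T" | T where "T \<in> G" "T \<subseteq> S" "(a # w, y) \<in> T"
      using S F(3) G(3) by blast
    then show "\<exists>S'\<in>?F. \<exists>k y'. step S a k S' \<and> y = k @ y' \<and> (w, y') \<in> S'"
    proof cases
      case 1
      then obtain S' k y' where "S' \<in> F" "step T a k S'" "y = k @ y'" "(w, y') \<in> S'"
        using residual_closedE[OF F(2)] by metis
      then show ?thesis using step_mono[of T a k S' S] 1 by blast
    next
      case 2
      then obtain S' k y' where "S' \<in> G" "step T a k S'" "y = k @ y'" "(w, y') \<in> S'"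
        using residual_closedE[OF G(2)] by metis
      then show ?thesis using step_mono[of T a k S' S] 2 by blast
    qed
  qed
  then show ?case
    using F(1) G(1) by (intro exI[of _ ?F]) simp
next
  case (rat_mult A B)
  then obtain F G where F: "finite F" "residual_closed F" "A \<in> F"
    and G: "finite G" "residual_closed G" "B \<in> G" by blast
  let ?F = "(\<lambda>S. pset_mult S B) ` F \<union> G"
  have "residual_closed ?F"
  proof (rule residual_closedI)
    fix S a w y assume S: "S \<in> ?F" "(a # w, y) \<in> S"
    consider "S \<in> G" | T where "T \<in> F" "S = pset_mult T B"
      using S by blast
    then show "\<exists>S'\<in>?F. \<exists>k y'. step S a k S' \<and> y = k @ y' \<and> (w, y') \<in> S'"
    proof cases
      case 1
      then show ?thesis using residual_closedE[OF G(2) _ S(2)] by (metis UnI2)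
    next
      case 2
      from pset_mult_cases[OF F(2) 2(1) S(2)[unfolded 2(2)]] show ?thesis
      proof (elim disjE bexE exE conjE)
        fix y0 y' assume *: "([], y0) \<in> T" "(a # w, y') \<in> B" "y = y0 @ y'"
        then obtain S' k y'' where S': "S' \<in> G" "step B a k S'" "y' = k @ y''" "(w, y'') \<in> S'"
          using residual_closedE[OF G(2,3)] by metis
        then have "step S a (y0 @ k) S'"
          using step_pset_mult_right[OF *(1)] 2 by blast
        then show ?thesis
          using S' * by (intro bexI[of _ S'] exI[of _ "y0 @ k"] exI[of _ y'']) auto
      qed (use 2 in blast)
    qed
  qed
  then show ?case
    using F G by (intro exI[of _ ?F]) auto
next
  case (rat_star A)
  then obtain F where F: "finite F" "residual_closed F" "A \<in> F" by blast
  let ?F = "insert (pstar A) ((\<lambda>S. pset_mult S (pstar A)) ` F)"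
  have star: "\<exists>S'\<in>?F. \<exists>k y'. step (pstar A) a k S' \<and> y = k @ y' \<and> (w, y') \<in> S'"
    if mem: "(a # w, y) \<in> pstar A" for a w y
  proof -
    obtain y0 x1 y1 x2 y2 where *: "([], y0) \<in> pstar A" "(a # x1, y1) \<in> A" "(x2, y2) \<in> pstar A"
      "w = x1 @ x2" "y = y0 @ y1 @ y2"
      using pstar_Cons[OF mem] by auto
    obtain S' k y' where S': "S' \<in> F" "step A a k S'" "y1 = k @ y'" "(x1, y') \<in> S'"
      using residual_closedE[OF F(2,3) *(2)] by metis
    have "step (pset_mult A (pstar A)) a k (pset_mult S' (pstar A))"
      using step_pset_mult_left[OF S'(2)] .
    then have "step (pstar A) a k (pset_mult S' (pstar A))"
      by (rule step_mono[OF _ pset_mult_pstar_subset])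
    \<comment> \<open>What the star writes on empty input before the letter goes into the label of
      the transition, so no state has to remember it.\<close>
    have "step (pstar A) a (y0 @ k) (pset_mult S' (pstar A))"
      unfolding step_def
    proof (clarify)
      fix w z assume "(w, z) \<in> pset_mult S' (pstar A)"
      then have "(a # w, k @ z) \<in> pstar A"
        using \<open>step (pstar A) a k _\<close> unfolding step_def by blast
      then show "(a # w, (y0 @ k) @ z) \<in> pstar A"
        using pstar_append[OF *(1)] unfolding pmult_def by fastforce
    qed
    moreover have "(w, y' @ y2) \<in> pset_mult S' (pstar A)"
      using pset_multI[OF S'(4) *(3)] * by simp
    ultimately show ?thesis
      using S' * by (intro bexI[of _ "pset_mult S' (pstar A)"] exI[of _ "y0 @ k"] exI[of _ "y' @ y2"]) auto
  qed
  have "residual_closed ?F"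
  proof (rule residual_closedI)
    fix S a w y assume S: "S \<in> ?F" "(a # w, y) \<in> S"
    consider "S = pstar A" | T where "T \<in> F" "S = pset_mult T (pstar A)"
      using S by blast
    then show "\<exists>S'\<in>?F. \<exists>k y'. step S a k S' \<and> y = k @ y' \<and> (w, y') \<in> S'"
    proof cases
      case 1
      then show ?thesis using star S(2) by blast
    next
      case 2
      from pset_mult_cases[OF F(2) 2(1) S(2)[unfolded 2(2)]] show ?thesis
      proof (elim disjE bexE exE conjE)
        fix y0 y' assume *: "([], y0) \<in> T" "(a # w, y') \<in> pstar A" "y = y0 @ y'"
        then obtain S' k y'' where S': "S' \<in> ?F" "step (pstar A) a k S'" "y' = k @ y''" "(w, y'') \<in> S'"
          using star[OF *(2)] by blast
        then have "step S a (y0 @ k) S'"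
          using step_pset_mult_right[OF *(1)] 2 by blast
        then show ?thesis
          using S' * by (intro bexI[of _ S'] exI[of _ "y0 @ k"] exI[of _ y'']) auto
      qed (use 2 in blast)
    qed
  qed
  then show ?case
    using F(1) by (intro exI[of _ ?F]) simp
qed

section \<open>Factorization into idempotents\<close>

text \<open>Its image under a homomorphism is the subsemigroup generated by the image of
  \<open>X\<close>; the star would add the value of the empty word.\<close>

definition lang_plus :: "'a list set \<Rightarrow> 'a list set" where
  "lang_plus X = {concat ws | ws. set ws \<subseteq> X \<and> ws \<noteq> []}"

lemma lang_star_def': "lang_star X = {concat ws | ws. set ws \<subseteq> X}"
  unfolding lang_star_def by auto

lemma lang_plus_subset_star: "lang_plus X \<subseteq> lang_star X"
  unfolding lang_plus_def lang_star_def' by blast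

lemma Nil_in_lang_star: "[] \<in> lang_star X"
  unfolding lang_star_def' by (auto intro: exI[of _ "[]"])

lemma lang_star_append:
  assumes "x \<in> lang_star X" "y \<in> lang_star X"
  shows "x @ y \<in> lang_star X"
proof -
  obtain vs ws where "x = concat vs" "y = concat ws" "set vs \<subseteq> X" "set ws \<subseteq> X"
    using assms unfolding lang_star_def' by blast
  then have "x @ y = concat (vs @ ws)" "set (vs @ ws) \<subseteq> X"
    by auto
  then show ?thesis
    unfolding lang_star_def' by blast
qed

lemma subset_lang_plus: "x \<in> X \<Longrightarrow> x \<in> lang_plus X"
  unfolding lang_plus_def by (auto intro!: exI[of _ "[x]"])

lemma subset_lang_star: "x \<in> X \<Longrightarrow> x \<in> lang_star X"
  using subset_lang_plus lang_plus_subset_star by blast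

lemma lang_star_plus_append:
  assumes "x \<in> lang_star X" "y \<in> lang_plus X"
  shows "x @ y \<in> lang_plus X" "y @ x \<in> lang_plus X"
proof -
  obtain vs ws where "x = concat vs" "y = concat ws" "set vs \<subseteq> X" "set ws \<subseteq> X" "ws \<noteq> []"
    using assms unfolding lang_star_def' lang_plus_def by blast
  then have "x @ y = concat (vs @ ws)" "y @ x = concat (ws @ vs)" "set (vs @ ws) \<subseteq> X"
    "set (ws @ vs) \<subseteq> X" "vs @ ws \<noteq> []" "ws @ vs \<noteq> []"
    by auto
  then show "x @ y \<in> lang_plus X" "y @ x \<in> lang_plus X"
    unfolding lang_plus_def by blast+
qed

lemma lang_plus_append: "x \<in> lang_plus X \<Longrightarrow> y \<in> lang_plus X \<Longrightarrow> x @ y \<in> lang_plus X"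
  using lang_star_plus_append(1) lang_plus_subset_star by blast

lemma lang_star_eq: "lang_star X = insert [] (lang_plus X)"
  unfolding lang_star_def' lang_plus_def by (auto intro: exI[of _ "[]"])

lemma lang_star_mono: "X \<subseteq> Y \<Longrightarrow> lang_star X \<subseteq> lang_star Y"
  unfolding lang_star_def' by blast

lemma lang_plus_mono: "X \<subseteq> Y \<Longrightarrow> lang_plus X \<subseteq> lang_plus Y"
  unfolding lang_plus_def by blast

lemma lang_multI: "x \<in> A \<Longrightarrow> y \<in> B \<Longrightarrow> x @ y \<in> lang_mult A B"
  unfolding lang_mult_def by blast

lemma lang_multE:
  assumes "w \<in> lang_mult A B"
  obtains x y where "w = x @ y" "x \<in> A" "y \<in> B"
  using assms unfolding lang_mult_def by blast

lemma lang_star_induct [consumes 1, case_names Nil append]: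
  assumes "w \<in> lang_star X" "P []" "\<And>x y. x \<in> X \<Longrightarrow> y \<in> lang_star X \<Longrightarrow> P y \<Longrightarrow> P (x @ y)"
  shows "P w"
proof -
  obtain ws where ws: "w = concat ws" "set ws \<subseteq> X"
    using assms(1) unfolding lang_star_def' by blast
  have "P (concat ws)" using ws(2)
  proof (induction ws)
    case (Cons x ws)
    then have "concat ws \<in> lang_star X"
      unfolding lang_star_def' by auto
    then show ?case using Cons assms(3) by simp
  qed (use assms in simp)
  then show ?thesis using ws by simp
qed

lemma lang_plus_induct [consumes 1, case_names single append]:
  assumes "w \<in> lang_plus X" "\<And>x. x \<in> X \<Longrightarrow> P x"
    "\<And>x y. x \<in> X \<Longrightarrow> y \<in> lang_plus X \<Longrightarrow> P y \<Longrightarrow> P (x @ y)"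
  shows "P w"
proof -
  obtain ws where ws: "w = concat ws" "set ws \<subseteq> X" "ws \<noteq> []"
    using assms(1) unfolding lang_plus_def by blast
  have "P (concat ws)" using ws(3,2)
  proof (induction ws rule: list_nonempty_induct)
    case (cons x ws)
    then have "concat ws \<in> lang_plus X"
      unfolding lang_plus_def by auto
    then show ?case using cons assms(3) by simp
  qed (use assms in simp)
  then show ?thesis using ws by simp
qed

text \<open>Factorization forests as a closure principle: no trees are built. A class of languages
  closed under these operations, with stars only for languages of one idempotent value, turns out to
  contain every language.\<close>

locale idempotent_star_closed =
  fixes mul :: "'m \<Rightarrow> 'm \<Rightarrow> 'm" (infixl "\<cdot>" 70)
    and \<phi> :: "'a::finite list \<Rightarrow> 'm"
    and I :: "'a list set \<Rightarrow> bool"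
  assumes assoc: "(a \<cdot> b) \<cdot> c = a \<cdot> (b \<cdot> c)"
    and hom: "\<phi> (x @ y) = \<phi> x \<cdot> \<phi> y"
    and finite_range: "finite (range \<phi>)"
    and I_mono: "I X \<Longrightarrow> Y \<subseteq> X \<Longrightarrow> I Y"
    and I_finite: "finite X \<Longrightarrow> I X"
    and I_Un: "I X \<Longrightarrow> I Y \<Longrightarrow> I (X \<union> Y)"
    and I_mult: "I X \<Longrightarrow> I Y \<Longrightarrow> I (lang_mult X Y)"
    and I_star: "I X \<Longrightarrow> \<phi> ` X \<subseteq> {e} \<Longrightarrow> e \<cdot> e = e \<Longrightarrow> I (lang_star X)"
begin

lemma I_UN: "finite A \<Longrightarrow> (\<And>a. a \<in> A \<Longrightarrow> I (F a)) \<Longrightarrow> I (\<Union>a\<in>A. F a)"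
  by (induction rule: finite_induct) (auto intro: I_finite I_Un)

lemma finite_image: "finite (\<phi> ` X)"
  by (rule finite_subset[OF _ finite_range]) auto

text \<open>In a left cancellative semigroup every word fixing a vertex of the right Cayley graph has the
  same idempotent value, so that decomposing walks at their visits to a vertex only
  stars languages with idempotent values.\<close>

lemma I_walks:
  assumes X: "I X"
    and cancel: "\<And>s u v. s \<in> \<phi> ` lang_plus X \<Longrightarrow> u \<in> \<phi> ` lang_plus X \<Longrightarrow> v \<in> \<phi> ` lang_plus X
      \<Longrightarrow> s \<cdot> u = s \<cdot> v \<Longrightarrow> u = v"
    and "finite V" "V \<subseteq> \<phi> ` lang_plus X" "s \<in> V"
  shows "I {concat ws | ws. set ws \<subseteq> X \<and> (\<forall>i\<in>{1..length ws}. s \<cdot> \<phi> (concat (take i ws)) \<in> V)}"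
  using assms(3-5)
proof (induction "card V" arbitrary: V s rule: less_induct)
  case less
  define N where "N V s = {concat ws | ws. set ws \<subseteq> X \<and> (\<forall>i\<in>{1..length ws}. s \<cdot> \<phi> (concat (take i ws)) \<in> V)}"
    for V s
  define W where "W = V - {s}"
  have "I (N W m)" if "m \<in> W" for m
    unfolding N_def
    by (rule less.hyps)
      (use that less.prems card_Diff1_less[of V s] in \<open>auto simp: W_def simp del: card_Diff_singleton\<close>)
  then have IW: "I (\<Union>m\<in>W. N W m)"
    by (intro I_UN) (use less.prems W_def in auto)
  \<comment> \<open>The part of a walk after its last return to s: empty, or one factor and then a
    walk avoiding s.\<close>
  define T where "T = insert [] (lang_mult X (\<Union>m\<in>W. N W m))"
  have IT: "I T"
    using I_Un[OF I_finite[of "{[]}"] I_mult[OF X IW]] unfolding T_def by simp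
  \<comment> \<open>Contains the first returns to s: one factor, or one factor out, a walk avoiding
    s, and one factor back. The start m of the middle walk is not tied to the first factor; the
    condition \<open>s \<cdot> \<phi> w = s\<close> alone forces the common value.\<close>
  define P where "P = {w \<in> X \<union> lang_mult (lang_mult X (\<Union>m\<in>W. N W m)) X. s \<cdot> \<phi> w = s}"
  have IP: "I P"
    by (rule I_mono[OF I_Un[OF X I_mult[OF I_mult[OF X IW] X]]]) (auto simp: P_def)
  have N_star: "N V m \<subseteq> lang_star X" for V m
    unfolding N_def lang_star_def' by blast
  have P_plus: "P \<subseteq> lang_plus X"
  proof -
    have "(x @ n) @ y \<in> lang_plus X" if "x \<in> X" "n \<in> N W m" "y \<in> X" for x n y m
      using that N_star by (intro lang_plus_append lang_star_plus_append(2) subset_lang_plus) auto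
    then show ?thesis
      unfolding P_def by (auto elim!: lang_multE intro: subset_lang_plus simp del: append_assoc)
  qed
  have s: "s \<in> \<phi> ` lang_plus X"
    using less.prems by blast
  \<comment> \<open>Both sides fix s, and s can be cancelled; the same argument identifies the
    values of any two members of P.\<close>
  have idem: "\<phi> p \<cdot> \<phi> p = \<phi> p" if "p \<in> P" for p
  proof -
    have "s \<cdot> (\<phi> p \<cdot> \<phi> p) = s \<cdot> \<phi> p"
      using that by (simp add: P_def flip: assoc)
    moreover have "\<phi> p \<cdot> \<phi> p \<in> \<phi> ` lang_plus X"
      using that P_plus by (auto simp flip: hom intro: lang_plus_append)
    ultimately show ?thesis
      using cancel[OF s] that P_plus by blast
  qed
  have "\<phi> p = \<phi> q" if "p \<in> P" "q \<in> P" for p q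
    by (rule cancel[OF s]) (use that P_plus in \<open>auto simp: P_def\<close>)
  then have "I (lang_star P)"
  proof (cases "P = {}")
    case True
    then show ?thesis
      by (intro I_finite) (simp add: lang_star_def)
  next
    case False
    then obtain p where "p \<in> P" by blast
    then show ?thesis
      using I_star[OF IP, of "\<phi> p"] idem \<open>\<And>q p. p \<in> P \<Longrightarrow> q \<in> P \<Longrightarrow> \<phi> p = \<phi> q\<close> by blast
  qed
  moreover have "N V s \<subseteq> lang_mult (lang_star P) T"
  proof
    fix w assume "w \<in> N V s"
    then obtain ws where "w = concat ws" "set ws \<subseteq> X" "\<forall>i\<in>{1..length ws}. s \<cdot> \<phi> (concat (take i ws)) \<in> V"
      unfolding N_def by blast
    then show "w \<in> lang_mult (lang_star P) T"
    proof (induction "length ws" arbitrary: ws w rule: less_induct)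
      case (less ws)
      note walk = less.prems(3)
      show ?case
      proof (cases ws)
        case Nil
        then show ?thesis
          using less.prems(1) lang_multI[OF Nil_in_lang_star[of P], of "[]" T] by (simp add: T_def)
      next
        case (Cons x xs)
        have x: "x \<in> X" "set xs \<subseteq> X"
          using less.prems Cons by auto
        \<comment> \<open>The range up to \<open>Suc (length us)\<close> also counts the leading x,
          so that the start \<open>s \<cdot> \<phi> x\<close> of the shortened walk differs from s
          as well.\<close>
        have walk_W: "concat us \<in> (\<Union>m\<in>W. N W m)"
          if pre: "prefix (x # us) ws" and ne: "\<forall>i\<in>{1..Suc (length us)}. s \<cdot> \<phi> (concat (take i ws)) \<noteq> s" for us
        proof -
          obtain rest where ws: "ws = x # us @ rest"
            using pre unfolding prefix_def by auto
          have in_W: "(s \<cdot> \<phi> x) \<cdot> \<phi> (concat (take i us)) \<in> W" if "i \<in> {1..length us}" for i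
          proof -
            have "s \<cdot> \<phi> (concat (take (Suc i) ws)) \<in> V - {s}"
              using walk[rule_format, of "Suc i"] ne[rule_format, of "Suc i"] that
              by (simp add: ws del: take_Suc_Cons)
            moreover have "take (Suc i) ws = x # take i us"
              using that by (simp add: ws)
            ultimately show ?thesis
              by (simp add: hom assoc W_def)
          qed
          have "s \<cdot> \<phi> (concat (take 1 ws)) \<in> V - {s}"
            using walk ne ws by (metis Diff_iff One_nat_def atLeastAtMost_iff le_refl length_Cons singletonD Suc_le_mono le0)
          then have "s \<cdot> \<phi> x \<in> W"
            by (simp add: ws W_def)
          moreover have "set us \<subseteq> X"
            using x ws Cons by auto
          ultimately show ?thesis
            using in_W unfolding N_def by blast
        qed
        show ?thesis
        proof (cases "\<exists>i\<in>{1..length ws}. s \<cdot> \<phi> (concat (take i ws)) = s")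
          case False
          then have "concat xs \<in> (\<Union>m\<in>W. N W m)"
            by (intro walk_W) (use Cons in auto)
          then have "w \<in> T"
            unfolding T_def using less.prems(1) Cons lang_multI[OF x(1)] by simp
          then show ?thesis
            using lang_multI[OF Nil_in_lang_star] by force
        next
          case True
          define i where "i = (LEAST i. i \<in> {1..length ws} \<and> s \<cdot> \<phi> (concat (take i ws)) = s)"
          have i: "i \<in> {1..length ws}" "s \<cdot> \<phi> (concat (take i ws)) = s"
            using LeastI_ex[of "\<lambda>i. i \<in> {1..length ws} \<and> s \<cdot> \<phi> (concat (take i ws)) = s"] True
            unfolding i_def by blast+
          have before_i: "s \<cdot> \<phi> (concat (take j ws)) \<noteq> s" if "j \<in> {1..<i}" for j
            using not_less_Least[of j "\<lambda>i. i \<in> {1..length ws} \<and> s \<cdot> \<phi> (concat (take i ws)) = s"] that i(1)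
            unfolding i_def[symmetric] by auto
          have "concat (take i ws) \<in> P"
          proof (cases "i = 1")
            case True
            then have "concat (take i ws) = x" using Cons by simp
            then show ?thesis using i(2) x by (simp add: P_def)
          next
            case False
            \<comment> \<open>The first i factors are x, then i - 2 factors spent away from s, then
              the returning factor \<open>xs ! (i - 2)\<close>.\<close>
            define us where "us = take (i - 2) xs"
            have "take i ws = x # take (i - 1) xs"
              using i(1) Cons by (cases i) auto
            also have "take (i - 1) xs = us @ [xs ! (i - 2)]"
            proof -
              have "2 \<le> i" "i \<le> Suc (length xs)"
                using i(1) False Cons by auto
              then have "i - 2 < length xs" "Suc (i - 2) = i - 1"
                by linarith+
              then show ?thesis
                using take_Suc_conv_app_nth[of "i - 2" xs] unfolding us_def by simp
            qed
            finally have split: "take i ws = x # us @ [xs ! (i - 2)]" .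
            have "length us \<le> i - 2"
              unfolding us_def by simp
            then have "{1..Suc (length us)} \<subseteq> {1..<i}"
              using i(1) False by auto
            then have "concat us \<in> (\<Union>m\<in>W. N W m)"
              using before_i by (intro walk_W) (auto simp: Cons us_def take_is_prefix)
            moreover have "xs ! (i - 2) \<in> X"
              using x i(1) False Cons by (intro subsetD[OF x(2)] nth_mem) auto
            ultimately have "(x @ concat us) @ xs ! (i - 2) \<in> lang_mult (lang_mult X (\<Union>m\<in>W. N W m)) X"
              using x by (intro lang_multI) auto
            then show ?thesis
              using i(2) split by (simp add: P_def)
          qed
          moreover have "concat (drop i ws) \<in> lang_mult (lang_star P) T"
          proof (rule less.hyps)
            show "length (drop i ws) < length ws"
              using i(1) by auto
            show "set (drop i ws) \<subseteq> X"
              using less.prems(2) set_drop_subset by fastforce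
            show "\<forall>j\<in>{1..length (drop i ws)}. s \<cdot> \<phi> (concat (take j (drop i ws))) \<in> V"
            proof
              fix j assume "j \<in> {1..length (drop i ws)}"
              then have "s \<cdot> \<phi> (concat (take (i + j) ws)) \<in> V"
                using walk i(1) by auto
              then show "s \<cdot> \<phi> (concat (take j (drop i ws))) \<in> V"
                using i(2) by (simp add: take_add hom flip: assoc)
            qed
          qed simp
          then obtain p r where "concat (drop i ws) = p @ r" "p \<in> lang_star P" "r \<in> T"
            by (rule lang_multE)
          moreover have "w = concat (take i ws) @ concat (drop i ws)"
            using less.prems(1) by (simp flip: concat_append)
          ultimately show ?thesis
            using lang_multI[of "concat (take i ws) @ p" "lang_star P" r T]
            by (simp add: lang_star_append subset_lang_star)
        qed
      qed
    qed
  qed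
  ultimately show ?case
    using I_mono[OF I_mult[OF _ IT]] unfolding N_def by blast
qed

text \<open>Lexicographic induction on the size of the semigroup \<open>U\<close> generated by the
  values of \<open>X\<close> and on the number of these values. If some value g together with its
  left multiples does not exhaust \<open>U\<close>, words are cut at the factors of value g; if
  products of two factors generate less than \<open>U\<close>, factors are paired. Otherwise left
  translations are injective on \<open>U\<close> and \<open>I_walks\<close> applies.\<close>

lemma I_lang_star:
  assumes "I X"
  shows "I (lang_star X)"
  using assms
proof (induction X rule: wf_induct_rule[OF wf_measures[of
      "[\<lambda>X. card (\<phi> ` lang_plus X), \<lambda>X. card (\<phi> ` X)]"]])
  case (1 X)
  define U where "U = \<phi> ` lang_plus X"
  have IH: "I (lang_star Y)" if "I Y" "\<phi> ` lang_plus Y \<subset> U" for Y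
    by (rule "1.IH"[OF _ that(1)]) (use that(2) in \<open>auto simp: U_def intro: psubset_card_mono finite_image\<close>)
  have U_mult: "u \<cdot> v \<in> U" if "u \<in> U" "v \<in> U" for u v
    using that unfolding U_def by (auto simp flip: hom intro: lang_plus_append)
  have X_U: "\<phi> ` X \<subseteq> U"
    unfolding U_def using subset_lang_plus by blast
  define Y where "Y = lang_mult X X"
  have Y_U: "\<phi> ` lang_plus Y \<subseteq> U"
  proof -
    have "w \<in> lang_plus X" if "w \<in> lang_plus Y" for w
      using that
    proof (induction rule: lang_plus_induct)
      case (single x)
      then show ?case
        unfolding Y_def by (auto elim!: lang_multE intro: subset_lang_plus lang_plus_append)
    next
      case (append x y)
      then show ?case
        unfolding Y_def by (auto elim!: lang_multE intro: subset_lang_plus lang_plus_append simp del: append_assoc)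
    qed
    then show ?thesis unfolding U_def by blast
  qed
  consider (left) g where "g \<in> \<phi> ` X" "insert g ((\<lambda>u. g \<cdot> u) ` U) \<noteq> U"
    | (square) "\<phi> ` lang_plus Y \<noteq> U"
    | (cancel) "\<And>g. g \<in> \<phi> ` X \<Longrightarrow> insert g ((\<lambda>u. g \<cdot> u) ` U) = U" "\<phi> ` lang_plus Y = U"
    by blast
  then show ?case
  proof cases
    case left
    \<comment> \<open>H loses the value g, which lowers the second measure. Products of blocks from
      the language Z below begin with a factor of value g, so their values stay in a proper subset
      of U, which lowers the first.\<close>
    define G where "G = {x \<in> X. \<phi> x = g}"
    define H where "H = X - G"
    have "I G" "I H"
      using I_mono[OF "1.prems"] by (auto simp: G_def H_def)
    have "g \<notin> \<phi> ` H" "\<phi> ` H \<subseteq> \<phi> ` X"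
      unfolding H_def G_def by auto
    then have "\<phi> ` H \<subset> \<phi> ` X"
      using left(1) by blast
    then have "card (\<phi> ` H) < card (\<phi> ` X)"
      by (intro psubset_card_mono finite_image)
    moreover have "card (\<phi> ` lang_plus H) \<le> card (\<phi> ` lang_plus X)"
      by (intro card_mono finite_image image_mono lang_plus_mono) (auto simp: H_def)
    ultimately have "I (lang_star H)"
      by (intro "1.IH"[OF _ \<open>I H\<close>]) auto
    define Z where "Z = lang_mult G (lang_star H)"
    have Z_X: "\<exists>x\<in>G. \<exists>r\<in>lang_star X. w = x @ r" if "w \<in> lang_plus Z" for w
    proof -
      have GH: "\<exists>x\<in>G. \<exists>r\<in>lang_star X. z = x @ r" if "z \<in> Z" for z
        using that lang_star_mono[of H X] unfolding Z_def H_def by (auto elim!: lang_multE)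
      show ?thesis
        using that
      proof (induction rule: lang_plus_induct)
        case (append z y)
        obtain x r where "z = x @ r" "x \<in> G" "r \<in> lang_star X"
          using GH append.hyps(1) by blast
        moreover have "y \<in> lang_star X"
          using append.IH lang_star_append[OF subset_lang_star] G_def by blast
        ultimately show ?case
          by (metis append_assoc lang_star_append)
      qed (use GH in blast)
    qed
    have "I Z"
      unfolding Z_def by (rule I_mult) fact+
    moreover have "\<phi> ` lang_plus Z \<subseteq> insert g ((\<lambda>u. g \<cdot> u) ` U)"
    proof
      fix m assume "m \<in> \<phi> ` lang_plus Z"
      then obtain x r where w: "x \<in> G" "r \<in> lang_star X" "m = \<phi> (x @ r)"
        using Z_X by blast
      then have "r = [] \<or> \<phi> r \<in> U" "\<phi> x = g"
        unfolding lang_star_eq U_def G_def by auto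
      then show "m \<in> insert g ((\<lambda>u. g \<cdot> u) ` U)"
        using w(3) by (metis append_Nil2 hom imageI insertI1 insertI2)
    qed
    moreover have "insert g ((\<lambda>u. g \<cdot> u) ` U) \<subseteq> U"
      using left(1) X_U U_mult by blast
    ultimately have "I (lang_star Z)"
      using left(2) by (intro IH) blast+
    moreover have "lang_star X \<subseteq> lang_mult (lang_star H) (lang_star Z)"
    proof
      fix w assume "w \<in> lang_star X"
      then show "w \<in> lang_mult (lang_star H) (lang_star Z)"
      proof (induction rule: lang_star_induct)
        case Nil
        then show ?case using lang_multI[OF Nil_in_lang_star Nil_in_lang_star] by force
      next
        case (append x y)
        then obtain h z where y: "y = h @ z" "h \<in> lang_star H" "z \<in> lang_star Z"
          by (auto elim: lang_multE)
        show ?case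
        proof (cases "x \<in> G")
          case True
          then have "x @ h \<in> Z"
            unfolding Z_def using y(2) by (rule lang_multI)
          then have "(x @ h) @ z \<in> lang_star Z"
            using y(3) subset_lang_star lang_star_append by blast
          then show ?thesis
            using lang_multI[OF Nil_in_lang_star] y(1) by force
        next
          case False
          then have "x @ h \<in> lang_star H"
            using append.hyps(1) y(2) subset_lang_star lang_star_append H_def by blast
          then show ?thesis
            using lang_multI[OF _ y(3)] y(1) by force
        qed
      qed
    qed
    ultimately show ?thesis
      using I_mono I_mult[OF \<open>I (lang_star H)\<close>] by blast
  next
    case square
    have "I Y"
      unfolding Y_def by (rule I_mult) fact+
    then have "I (lang_star Y)"
      using Y_U square by (intro IH) blast+
    then have "I (lang_star Y \<union> lang_mult X (lang_star Y))"
      by (intro I_Un I_mult "1.prems")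
    moreover have "lang_star X \<subseteq> lang_star Y \<union> lang_mult X (lang_star Y)"
    proof
      fix w assume "w \<in> lang_star X"
      then show "w \<in> lang_star Y \<union> lang_mult X (lang_star Y)"
      proof (induction rule: lang_star_induct)
        case (append x y)
        then show ?case
        proof (elim UnE)
          assume "y \<in> lang_mult X (lang_star Y)"
          then obtain x' z where y: "y = x' @ z" "x' \<in> X" "z \<in> lang_star Y"
            by (rule lang_multE)
          then have "x @ x' \<in> Y"
            unfolding Y_def using append.hyps(1) by (intro lang_multI)
          then have "(x @ x') @ z \<in> lang_star Y"
            using y(3) subset_lang_star lang_star_append by blast
          then show ?thesis
            using y(1) by simp
        qed (auto intro: lang_multI)
      qed (simp add: Nil_in_lang_star)
    qed
    ultimately show ?thesis
      by (rule I_mono)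
  next
    case cancel
    have "finite U"
      unfolding U_def by (rule finite_image)
    \<comment> \<open>Products of two factors still generate U, so g is itself a product in U. This
      puts g among its own multiples; left translation by g then maps the finite set U onto itself
      and is injective.\<close>
    have inj_X: "inj_on (\<lambda>u. g \<cdot> u) U" if g: "g \<in> \<phi> ` X" for g
    proof -
      have "g \<in> \<phi> ` lang_plus Y"
        using g X_U cancel(2) by blast
      then obtain w where "g = \<phi> w" "w \<in> lang_plus Y" by blast
      then have "\<exists>u1\<in>U. \<exists>u2\<in>U. g = u1 \<cdot> u2"
      proof -
        have "\<exists>x\<in>X. \<exists>r\<in>lang_plus X. w = x @ r"
          using \<open>w \<in> lang_plus Y\<close>
        proof (induction rule: lang_plus_induct)
          case (single y)
          then show ?case
            unfolding Y_def by (auto elim!: lang_multE intro: subset_lang_plus)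
        next
          case (append y r)
          then obtain x x' where "y = x @ x'" "x \<in> X" "x' \<in> X"
            unfolding Y_def by (auto elim: lang_multE)
          moreover have "r \<in> lang_plus X"
            using append.IH subset_lang_plus lang_plus_append by blast
          ultimately show ?case
            by (metis append_assoc subset_lang_plus lang_plus_append)
        qed
        then show ?thesis
          using X_U \<open>g = \<phi> w\<close> hom unfolding U_def by blast
      qed
      then obtain u1 u2 where u: "u1 \<in> U" "u2 \<in> U" "g = u1 \<cdot> u2" by blast
      have "g \<in> (\<lambda>u. g \<cdot> u) ` U"
      proof (cases "u1 = g")
        case True
        then show ?thesis using u by blast
      next
        case False
        then obtain v where "v \<in> U" "u1 = g \<cdot> v"
          using cancel(1)[OF g] u(1) by blast
        then have "g = g \<cdot> (v \<cdot> u2)" "v \<cdot> u2 \<in> U"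
          using u U_mult by (metis assoc)+
        then show ?thesis by blast
      qed
      then have "(\<lambda>u. g \<cdot> u) ` U = U"
        using cancel(1)[OF g] by (simp add: insert_absorb)
      then show ?thesis
        using \<open>finite U\<close> by (metis eq_card_imp_inj_on)
    qed
    have inj: "inj_on (\<lambda>u. \<phi> w \<cdot> u) U" if "w \<in> lang_plus X" for w
      using that
    proof (induction rule: lang_plus_induct)
      case (append x y)
      have "\<phi> y \<in> U"
        using append.hyps(2) unfolding U_def by blast
      then have "(\<lambda>u. \<phi> y \<cdot> u) ` U \<subseteq> U"
        using U_mult by blast
      then have "inj_on ((\<lambda>u. \<phi> x \<cdot> u) \<circ> (\<lambda>u. \<phi> y \<cdot> u)) U"
        using append inj_X by (intro comp_inj_on) (auto intro: inj_on_subset)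
      then show ?case
        by (simp add: hom assoc comp_def)
    qed (use inj_X in blast)
    \<comment> \<open>The semigroup offers no identity vertex to start from; the first factor x of a
      word serves to fix the start \<open>\<phi> x\<close>.\<close>
    define N where "N s = {concat ws | ws. set ws \<subseteq> X \<and> (\<forall>i\<in>{1..length ws}. s \<cdot> \<phi> (concat (take i ws)) \<in> U)}" for s
    have "I (N s)" if "s \<in> U" for s
      unfolding N_def
    proof (rule I_walks[OF "1.prems" _ \<open>finite U\<close>])
      fix s u v assume "s \<in> \<phi> ` lang_plus X" "u \<in> \<phi> ` lang_plus X" "v \<in> \<phi> ` lang_plus X" "s \<cdot> u = s \<cdot> v"
      then show "u = v"
        using inj unfolding U_def by (auto dest: inj_onD)
    qed (use that in \<open>auto simp: U_def\<close>)
    then have "I (insert [] (lang_mult X (\<Union>s\<in>\<phi> ` X. N s)))"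
      using X_U I_Un[OF I_finite[of "{[]}"] I_mult[OF "1.prems" I_UN[OF finite_image, of X N]]] by auto
    moreover have "lang_star X \<subseteq> insert [] (lang_mult X (\<Union>s\<in>\<phi> ` X. N s))"
    proof
      fix w assume "w \<in> lang_star X"
      then obtain ws where ws: "w = concat ws" "set ws \<subseteq> X"
        unfolding lang_star_def' by blast
      show "w \<in> insert [] (lang_mult X (\<Union>s\<in>\<phi> ` X. N s))"
      proof (cases ws)
        case (Cons x xs)
        have "\<phi> x \<cdot> \<phi> (concat (take i xs)) \<in> U" for i
        proof -
          have "x @ concat (take i xs) = concat (take (Suc i) ws)" "set (take (Suc i) ws) \<subseteq> X" "take (Suc i) ws \<noteq> []"
            using Cons ws(2) set_take_subset[of "Suc i" ws] by auto
          then have "x @ concat (take i xs) \<in> lang_plus X"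
            unfolding lang_plus_def by blast
          then show ?thesis
            unfolding U_def by (metis hom imageI)
        qed
        then have "concat xs \<in> N (\<phi> x)"
          using ws(2) Cons unfolding N_def by auto
        then show ?thesis
          using ws Cons by (auto intro!: lang_multI)
      qed (use ws in simp)
    qed
    ultimately show ?thesis
      by (rule I_mono)
  qed
qed

lemma I_UNIV: "I UNIV"
proof -
  have "w \<in> lang_star (range (\<lambda>a. [a]))" for w :: "'a list"
  proof (induction w)
    case (Cons a w)
    then show ?case
      using lang_star_append[OF subset_lang_star[of "[a]" "range (\<lambda>a. [a])"] Cons.IH] by simp
  qed (rule Nil_in_lang_star)
  moreover have "I (lang_star (range (\<lambda>a. [a :: 'a])))"
    by (intro I_lang_star I_finite) simp
  ultimately show ?thesis
    by (metis I_mono subsetI)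
qed

end

section \<open>Bounded languages\<close>

lemma poly_bound_lang_prod:
  "poly_bound (\<lambda>n. card {w \<in> lang_prod (map word_star ws). length w \<le> n})"
  (is "poly_bound (\<lambda>n. card (?L ws n))")
proof -
  have "finite (?L ws n) \<and> card (?L ws n) \<le> (n + 1) ^ length ws" for n
  proof (induction ws)
    case Nil
    have "?L [] n = {[]}" by auto
    then show ?case by simp
  next
    case (Cons u ws)
    have "?L (u # ws) n \<subseteq> (\<lambda>(i, w). concat (replicate i u) @ w) ` ({..n} \<times> ?L ws n)"
    proof
      fix w assume w: "w \<in> ?L (u # ws) n"
      then obtain i w' where *: "w = concat (replicate i u) @ w'" "w' \<in> lang_prod (map word_star ws)"
        by (fastforce simp: word_star_def[of u] elim: lang_multE)
      show "w \<in> (\<lambda>(i, w). concat (replicate i u) @ w) ` ({..n} \<times> ?L ws n)"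
      \<comment> \<open>Powers of the empty word do not bound the exponent, so the exponent 0 is
        chosen for it.\<close>
      proof (cases "u = []")
        case True
        then have "w = concat (replicate 0 u) @ w'"
          using * by simp
        then show ?thesis
          using * w by (intro image_eqI[of _ _ "(0, w')"]) auto
      next
        case False
        then have "i \<le> i * length u" by (cases u) auto
        moreover have "i * length u \<le> n"
          using * w by (simp add: length_concat sum_list_replicate)
        ultimately have "i \<le> n"
          by linarith
        then show ?thesis
          using * w by (intro image_eqI[of _ _ "(i, w')"]) auto
      qed
    qed
    moreover have fin: "finite ((\<lambda>(i, w). concat (replicate i u) @ w) ` ({..n} \<times> ?L ws n))"
      using Cons by auto
    ultimately have "finite (?L (u # ws) n)"
      "card (?L (u # ws) n) \<le> card ((\<lambda>(i, w). concat (replicate i u) @ w) ` ({..n} \<times> ?L ws n))"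
      by (rule finite_subset, rule card_mono[rotated])
    note this(2)
    also have "card ((\<lambda>(i, w). concat (replicate i u) @ w) ` ({..n} \<times> ?L ws n)) \<le> card ({..n} \<times> ?L ws n)"
      using Cons by (intro card_image_le) auto
    also have "\<dots> = card {..n} * card (?L ws n)"
      by (simp add: card_cartesian_product)
    also have "\<dots> \<le> (n + 1) * (n + 1) ^ length ws"
      using Cons by (intro mult_mono) auto
    finally show ?case
      using \<open>finite (?L (u # ws) n)\<close> by simp
  qed
  moreover have "poly_bound (\<lambda>n. (1 * n + 1) ^ length ws)"
    by (intro poly_bound_power poly_bound_linear)
  ultimately show ?thesis
    by (auto intro: poly_bound_mono)
qed

lemma poly_bound_bounded_lang:
  fixes K :: "'b::finite list set"
  assumes "bounded_lang K"
  shows "poly_bound (\<lambda>n. card {w \<in> K. length w \<le> n})"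
proof -
  obtain ws where "K \<subseteq> lang_prod (map word_star ws)"
    using assms unfolding bounded_lang_def by blast
  then show ?thesis
    by (intro poly_bound_mono[OF poly_bound_lang_prod[of ws]] card_mono)
      (auto intro: finite_subset[OF _ finite_words_le])
qed

lemma lang_star_subset: "X \<subseteq> lang_star Y \<Longrightarrow> lang_star X \<subseteq> lang_star Y"
proof
  fix w assume "X \<subseteq> lang_star Y" "w \<in> lang_star X"
  from this(2,1) show "w \<in> lang_star Y"
    by (induction rule: lang_star_induct) (auto intro: Nil_in_lang_star lang_star_append)
qed

text \<open>Otherwise the free choice between \<open>x @ y\<close> and \<open>y @ x\<close> gives 2
  ^ m words of length linear in m, too many for a bounded language.\<close>

lemma bounded_lang_commute:
  fixes K :: "'b::finite list set"
  assumes "bounded_lang K" and "\<And>w. w \<in> lang_star {x, y} \<Longrightarrow> a @ w @ r \<in> K"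
  shows "x @ y = y @ x"
proof (rule ccontr)
  assume "x @ y \<noteq> y @ x"
  note inj = card_commuting_products[OF this]
  define L where "L = length (x @ y)"
  define W where "W m = {ws. set ws \<subseteq> {x @ y, y @ x} \<and> length ws = m}" for m
  have "2 ^ m \<le> card {w \<in> K. length w \<le> L * m + length (a @ r)}" for m
  proof -
    have "inj_on (\<lambda>ws. a @ concat ws @ r) (W m)"
      using inj(1)[of m] unfolding inj_on_def W_def by auto
    then have "2 ^ m = card ((\<lambda>ws. a @ concat ws @ r) ` W m)"
      using inj(2)[of m] by (simp add: card_image W_def)
    also have "\<dots> \<le> card {w \<in> K. length w \<le> L * m + length (a @ r)}"
    proof (rule card_mono)
      show "finite {w \<in> K. length w \<le> L * m + length (a @ r)}"
        by (auto intro: finite_subset[OF _ finite_words_le])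
      have "a @ concat ws @ r \<in> K \<and> length (a @ concat ws @ r) \<le> L * m + length (a @ r)"
        if "ws \<in> W m" for ws
      proof
        have "{x @ y, y @ x} \<subseteq> lang_star {x, y}"
          by (auto intro: lang_star_append subset_lang_star)
        moreover have "concat ws \<in> lang_star {x @ y, y @ x}"
          using that unfolding W_def lang_star_def' by blast
        ultimately show "a @ concat ws @ r \<in> K"
          using assms(2) lang_star_subset by blast
        have "length (concat ws) \<le> m * L"
          using that unfolding W_def L_def by (auto intro!: length_concat_le dest!: subsetD)
        then show "length (a @ concat ws @ r) \<le> L * m + length (a @ r)"
          by (simp add: mult.commute)
      qed
      then show "(\<lambda>ws. a @ concat ws @ r) ` W m \<subseteq> {w \<in> K. length w \<le> L * m + length (a @ r)}"
        by blast
    qed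
    finally show ?thesis .
  qed
  moreover have "poly_bound (\<lambda>m. card {w \<in> K. length w \<le> L * m + length (a @ r)})"
    using poly_bound_comp_linear[OF poly_bound_bounded_lang[OF assms(1)]] .
  ultimately show False
    using not_poly_bound_exp poly_bound_mono by blast
qed

section \<open>Closure properties of bounded languages\<close>

lemma lang_prod_append: "lang_prod (As @ Bs) = lang_mult (lang_prod As) (lang_prod Bs)"
proof (induction As)
  case Nil
  then show ?case by (auto simp: lang_mult_def)
next
  case (Cons A As)
  then show ?case by (auto simp: lang_mult_def) (metis append_assoc)+
qed

lemma Nil_in_lang_prod_stars: "[] \<in> lang_prod (map word_star ws)"
proof (induction ws)
  case (Cons w ws)
  have "[] \<in> word_star w"
    unfolding word_star_def by (auto intro: exI[of _ 0])
  then show ?case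
    using Cons lang_multI[of "[]" _ "[]"] by fastforce
qed simp

lemma bounded_lang_mono: "bounded_lang L \<Longrightarrow> K \<subseteq> L \<Longrightarrow> bounded_lang K"
  unfolding bounded_lang_def by blast

lemma bounded_lang_mult:
  assumes "bounded_lang K" "bounded_lang L"
  shows "bounded_lang (lang_mult K L)"
proof -
  obtain vs ws where "K \<subseteq> lang_prod (map word_star vs)" "L \<subseteq> lang_prod (map word_star ws)"
    using assms unfolding bounded_lang_def by blast
  then have "lang_mult K L \<subseteq> lang_prod (map word_star (vs @ ws))"
    unfolding map_append lang_prod_append by (auto elim!: lang_multE intro!: lang_multI)
  then show ?thesis
    unfolding bounded_lang_def by blast
qed

lemma bounded_lang_Un:
  assumes "bounded_lang K" "bounded_lang L"
  shows "bounded_lang (K \<union> L)"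
proof -
  obtain vs ws where *: "K \<subseteq> lang_prod (map word_star vs)" "L \<subseteq> lang_prod (map word_star ws)"
    using assms unfolding bounded_lang_def by blast
  have "x \<in> lang_prod (map word_star (vs @ ws))" if "x \<in> K \<union> L" for x
    using that * lang_multI[OF _ Nil_in_lang_prod_stars, of x _ ws]
      lang_multI[OF Nil_in_lang_prod_stars, of x _ vs]
    unfolding map_append lang_prod_append by auto
  then show ?thesis
    unfolding bounded_lang_def by blast
qed

lemma bounded_lang_word_star: "bounded_lang (word_star w)"
  unfolding bounded_lang_def
  by (rule exI[of _ "[w]"]) (auto simp: lang_mult_def)

lemma bounded_lang_singleton: "bounded_lang {w}"
  by (rule bounded_lang_mono[OF bounded_lang_word_star[of w]])
    (auto simp: word_star_def intro: exI[of _ 1])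

lemma bounded_lang_empty: "bounded_lang {}"
  by (rule bounded_lang_mono[OF bounded_lang_singleton]) simp

lemma bounded_lang_UN: "finite A \<Longrightarrow> (\<And>a. a \<in> A \<Longrightarrow> bounded_lang (f a)) \<Longrightarrow> bounded_lang (\<Union>a\<in>A. f a)"
  by (induction rule: finite_induct) (auto intro: bounded_lang_empty bounded_lang_Un)

text \<open>Each word is a power of a fixed nonempty c followed by one of the finitely many prefixes
  of c.\<close>

lemma bounded_lang_commuting:
  assumes "\<And>x y. x \<in> K \<Longrightarrow> y \<in> K \<Longrightarrow> x @ y = y @ x"
  shows "bounded_lang K"
proof (cases "K \<subseteq> {[]}")
  case True
  then show ?thesis
    by (rule bounded_lang_mono[OF bounded_lang_singleton])
next
  case False
  then obtain c where c: "c \<in> K" "c \<noteq> []" by blast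
  have "K \<subseteq> lang_mult (word_star c) (\<Union>p\<in>set (prefixes c). {p})"
  proof
    fix y assume "y \<in> K"
    then obtain k p where "y = concat (replicate k c) @ p" "prefix p c"
      using commute_prefix[of c y] assms c by blast
    then show "y \<in> lang_mult (word_star c) (\<Union>p\<in>set (prefixes c). {p})"
      by (auto simp: word_star_def intro!: lang_multI)
  qed
  then show ?thesis
    by (rule bounded_lang_mono[rotated])
      (intro bounded_lang_mult bounded_lang_word_star bounded_lang_UN bounded_lang_singleton finite_set)
qed

section \<open>Separating two pumped words\<close>

lemma commute_concat: "(\<And>x. x \<in> set xs \<Longrightarrow> x @ w = w @ x) \<Longrightarrow> concat xs @ w = w @ concat xs"
proof (induction xs)
  case (Cons x xs)
  then have "x @ concat xs @ w = (x @ w) @ concat xs" by simp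
  also have "\<dots> = w @ x @ concat xs" using Cons.prems[of x] by simp
  finally show ?case by simp
qed simp

lemma same_length_prefix_eq: "prefix x z \<Longrightarrow> prefix y z \<Longrightarrow> length x = length y \<Longrightarrow> x = y"
  by (auto simp: prefix_def append_eq_append_conv)

text \<open>Pumping \<open>p q\<close> often enough forces equal words to be compatible on a whole period,
  and the equality then persists when all pumped factors are removed.\<close>

lemma pump_equal_lengths:
  fixes A B :: "'x \<Rightarrow> 'c list"
  assumes len: "\<And>x. x \<in> {p, q} \<Longrightarrow> length (A x) = length (B x)"
    and A: "\<And>x y. x \<in> {p, q} \<Longrightarrow> y \<in> {p, q} \<Longrightarrow> A x @ A y = A y @ A x"
    and B: "\<And>x y. x \<in> {p, q} \<Longrightarrow> y \<in> {p, q} \<Longrightarrow> B x @ B y = B y @ B x"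
    and ab: "length a \<le> length b" and ws: "set ws \<subseteq> {p, q}"
    and vs: "vs = concat (replicate (length b - length a + 2) [p, q])"
    and eq: "a @ concat (map A (ws @ vs)) @ R = b @ concat (map B (ws @ vs)) @ R'"
  shows "a @ R = b @ R'"
proof -
  \<comment> \<open>The difference of the lengths is the length of the overhang g. A nonempty period
    has at least one letter, so k periods cover g and a further whole period.\<close>
  define k where "k = length b - length a + 2"
  define \<pi> where "\<pi> = A p @ A q"
  define \<tau> where "\<tau> = B p @ B q"
  define P where "P = concat (replicate k \<pi>)"
  have rep: "concat (map f (concat (replicate m [p, q]))) = concat (replicate m (f p @ f q))"
    for f :: "'x \<Rightarrow> 'c list" and m
    by (induction m) auto
  have vs_set: "set vs \<subseteq> {p, q}"
    unfolding vs by auto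
  obtain g where g: "b = a @ g"
    by (metis ab append_eq_append_conv_if append_eq_conv_conj eq)
  have "A x @ \<pi> = \<pi> @ A x" if "x \<in> {p, q}" for x
    using A[OF that, of p] A[OF that, of q] unfolding \<pi>_def by (metis append.assoc insertCI)
  then have comm_P: "A x @ P = P @ A x" if "x \<in> {p, q}" for x
    using commute_concat[of "replicate k \<pi>" "A x"] that unfolding P_def by auto
  have "concat (map A ws) @ P = P @ concat (map A ws)"
    using ws comm_P by (intro commute_concat) auto
  moreover have "concat (map A vs) = P"
    unfolding P_def \<pi>_def vs rep k_def ..
  ultimately have "concat (map A (ws @ vs)) = P @ concat (map A ws)"
    by simp
  then have eq': "P @ concat (map A ws) @ R = g @ concat (map B (ws @ vs)) @ R'"
    using eq unfolding g by simp
  have "B x @ \<tau> = \<tau> @ B x" if "x \<in> {p, q}" for x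
    using B[OF that, of p] B[OF that, of q] unfolding \<tau>_def by (metis append.assoc insertCI)
  then have "concat (map B ws) @ concat (replicate k \<tau>) = concat (replicate k \<tau>) @ concat (map B ws)"
    using ws by (intro commute_concat sym[OF commute_concat]) auto
  then have eq'': "P @ concat (map A ws) @ R = g @ concat (replicate k \<tau>) @ concat (map B ws) @ R'"
  proof -
    have "concat (map B vs) = concat (replicate k \<tau>)"
      unfolding \<tau>_def vs rep k_def ..
    then have "concat (map B (ws @ vs)) = concat (replicate k \<tau>) @ concat (map B ws)"
      using \<open>concat (map B ws) @ _ = _\<close> by simp
    then show ?thesis
      using eq' by simp
  qed
  \<comment> \<open>Both sides are prefixes of P of equal length. The right one is, because the
    other word begins with g and \<tau>, and \<tau> begins with \<open>B x\<close> by commutation;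
    the left one is, because P begins with g and commutes with \<open>A x\<close>.\<close>
  have step: "A x @ g = g @ B x" if x: "x \<in> {p, q}" for x
  proof (cases "\<pi> = []")
    case True
    then have "A p = []" "A q = []" "B p = []" "B q = []"
      using len[of p] len[of q] unfolding \<pi>_def by auto
    then show ?thesis using x by auto
  next
    case False
    then have "1 \<le> length \<pi>" by (cases \<pi>) auto
    then have "length g * 1 \<le> length g * length \<pi>"
      by (intro mult_left_mono) auto
    then have P_long: "length g + length \<pi> \<le> length P"
    proof -
      have "length P = length g * length \<pi> + 2 * length \<pi>"
        unfolding P_def k_def g by (simp add: length_concat sum_list_replicate)
      then show ?thesis
        using \<open>length g * 1 \<le> _\<close> by linarith
    qed
    have Ax: "length (A x) \<le> length \<pi>" "length (B x) = length (A x)"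
      using x len[OF x] unfolding \<pi>_def by auto
    have "prefix (B x) \<tau>"
      using x B[of p q] unfolding \<tau>_def by (metis empty_iff insert_iff prefixI)
    then have "prefix (g @ B x) (g @ concat (replicate k \<tau>) @ concat (map B ws) @ R')"
      unfolding k_def by (simp add: numeral_2_eq_2 prefix_prefix)
    then have "prefix (g @ B x) (P @ concat (map A ws) @ R)"
      using eq'' by simp
    then have 1: "prefix (g @ B x) P"
      by (rule prefix_length_prefix) (use P_long Ax in auto)
    then have "prefix g P"
      by (rule append_prefixD)
    then have "prefix (A x @ g) (P @ A x)"
      using comm_P[OF x, symmetric] by simp
    then have "prefix (A x @ g) P"
      by (rule prefix_length_prefix) (use P_long Ax in auto)
    with 1 show ?thesis
      using Ax by (intro same_length_prefix_eq[of _ P]) auto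
  qed
  \<comment> \<open>Moving g through the pumped part turns blocks of A into blocks of B, after which
    the pumped part cancels.\<close>
  have "concat (map A us) @ g = g @ concat (map B us)" if "set us \<subseteq> {p, q}" for us
    using that
  proof (induction us)
    case (Cons u us)
    then have "concat (map A (u # us)) @ g = (A u @ g) @ concat (map B us)" by simp
    also have "\<dots> = g @ concat (map B (u # us))"
      using Cons.prems step[of u] by simp
    finally show ?case .
  qed simp
  then have "concat (map A (ws @ vs)) @ g = g @ concat (map B (ws @ vs))"
    using ws vs_set by simp
  moreover have "concat (map A (ws @ vs)) @ R = (g @ concat (map B (ws @ vs))) @ R'"
    using eq unfolding g append_assoc same_append_eq .
  ultimately have "concat (map A (ws @ vs)) @ R = concat (map A (ws @ vs)) @ g @ R'"
    unfolding append_assoc[symmetric] by metis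
  then have "R = g @ R'"
    unfolding same_append_eq .
  then show ?thesis
    unfolding g by simp
qed

text \<open>Each copy of \<open>x\<close> shifts the difference of the total lengths by the same
  nonzero amount. At most n blocks in \<open>ws\<close> change it by at most \<open>L * n\<close>,
  so \<open>c * n + c\<close> copies outweigh \<open>ws\<close> and the fixed ends.\<close>

lemma pump_unequal_lengths:
  fixes A B :: "'x \<Rightarrow> 'c list"
  assumes "x \<in> {p, q}" "length (A x) \<noteq> length (B x)"
  shows "\<exists>c. \<forall>n. \<forall>ws. set ws \<subseteq> {p, q} \<longrightarrow> length ws \<le> n \<longrightarrow>
    a @ concat (map A (ws @ replicate (c * n + c) x)) @ R \<noteq> b @ concat (map B (ws @ replicate (c * n + c) x)) @ R'"
proof -
  define D where "D ws = int (length (concat (map A ws))) - int (length (concat (map B ws)))" for ws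
  define d where "d = int (length (A x)) - int (length (B x))"
  define L where "L = length (A p) + length (A q) + length (B p) + length (B q)"
  define c where "c = length a + length b + length R + length R' + L + 1"
  have "D ws + int (c * n + c) * d + int (length (a @ R)) - int (length (b @ R')) \<noteq> 0"
    if ws: "set ws \<subseteq> {p, q}" "length ws \<le> n" for ws n
  proof -
    have "length (concat (map A ws)) \<le> length ws * L" "length (concat (map B ws)) \<le> length ws * L"
      by (rule length_concat_map_le; use ws in \<open>auto simp: L_def\<close>)+
    moreover have "length ws * L \<le> L * n"
      using ws(2) by (simp add: mult.commute)
    ultimately have "\<bar>D ws\<bar> \<le> int (L * n)"
      unfolding D_def by linarith
    moreover have "L * n \<le> c * n"
      unfolding c_def by (intro mult_right_mono) auto
    then have "int (L * n) \<le> int (c * n)"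
      by (rule zle_int[THEN iffD2])
    moreover have "\<bar>int (length (a @ R)) - int (length (b @ R'))\<bar> < int c"
      unfolding c_def by simp
    ultimately have "\<bar>D ws\<bar> + \<bar>int (length (a @ R)) - int (length (b @ R'))\<bar> < int (c * n + c)"
      by linarith
    moreover have "int (c * n + c) * 1 \<le> int (c * n + c) * \<bar>d\<bar>"
      using assms(2) unfolding d_def by (intro mult_left_mono) auto
    then have "int (c * n + c) \<le> \<bar>int (c * n + c) * d\<bar>"
      by (simp add: abs_mult)
    ultimately show ?thesis
      by linarith
  qed
  moreover have "D (ws @ replicate m x) = D ws + int m * d" for ws m
    unfolding D_def d_def by (simp add: length_concat sum_list_replicate algebra_simps)
  ultimately have "D (ws @ replicate (c * n + c) x) + int (length (a @ R)) - int (length (b @ R')) \<noteq> 0"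
    if "set ws \<subseteq> {p, q}" "length ws \<le> n" for ws n
    using that by simp
  moreover have "D us + int (length (a @ R)) - int (length (b @ R')) = 0"
    if "a @ concat (map A us) @ R = b @ concat (map B us) @ R'" for us
    using arg_cong[OF that, of length] unfolding D_def by simp
  ultimately show ?thesis
    by blast
qed

text \<open>The tail \<open>vs\<close> may depend on n but must serve every \<open>ws\<close> of at
  most n blocks. If some block has outputs of different lengths, linearly many copies drive the
  totals apart; otherwise one tail serves all n.\<close>

lemma pump_separates:
  fixes A B :: "'x \<Rightarrow> 'c list"
  assumes A: "\<And>x y. x \<in> {p, q} \<Longrightarrow> y \<in> {p, q} \<Longrightarrow> A x @ A y = A y @ A x"
    and B: "\<And>x y. x \<in> {p, q} \<Longrightarrow> y \<in> {p, q} \<Longrightarrow> B x @ B y = B y @ B x"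
    and ne: "a @ R \<noteq> b @ R'"
  shows "\<exists>c. \<forall>n. \<exists>vs. set vs \<subseteq> {p, q} \<and> length vs \<le> c * n + c \<and>
    (\<forall>ws. set ws \<subseteq> {p, q} \<longrightarrow> length ws \<le> n \<longrightarrow>
      a @ concat (map A (ws @ vs)) @ R \<noteq> b @ concat (map B (ws @ vs)) @ R')"
proof (cases "\<exists>x\<in>{p, q}. length (A x) \<noteq> length (B x)")
  case True
  then obtain x where x: "x \<in> {p, q}" "length (A x) \<noteq> length (B x)" by blast
  obtain c where "\<forall>n. \<forall>ws. set ws \<subseteq> {p, q} \<longrightarrow> length ws \<le> n \<longrightarrow>
    a @ concat (map A (ws @ replicate (c * n + c) x)) @ R \<noteq> b @ concat (map B (ws @ replicate (c * n + c) x)) @ R'"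
    using pump_unequal_lengths[where A = A and B = B and a = a and R = R and b = b and R' = R', OF x] by blast
  then show ?thesis
    using x(1) by (intro exI[of _ c] allI, rule_tac x = "replicate (c * n + c) x" in exI) auto
next
  case False
  then have len: "\<And>x. x \<in> {p, q} \<Longrightarrow> length (A x) = length (B x)" by blast
  have "\<exists>vs. set vs \<subseteq> {p, q} \<and> (\<forall>ws. set ws \<subseteq> {p, q} \<longrightarrow>
      a @ concat (map A (ws @ vs)) @ R \<noteq> b @ concat (map B (ws @ vs)) @ R')"
  proof (cases "length a \<le> length b")
    case True
    let ?vs = "concat (replicate (length b - length a + 2) [p, q])"
    have "a @ concat (map A (ws @ ?vs)) @ R \<noteq> b @ concat (map B (ws @ ?vs)) @ R'" if "set ws \<subseteq> {p, q}" for ws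
      using pump_equal_lengths[where A = A and B = B, OF len A B True that refl] ne by blast
    moreover have "set ?vs \<subseteq> {p, q}" by auto
    ultimately show ?thesis by blast
  next
    case False
    then have ba: "length b \<le> length a" by simp
    let ?vs = "concat (replicate (length a - length b + 2) [p, q])"
    have "a @ concat (map A (ws @ ?vs)) @ R \<noteq> b @ concat (map B (ws @ ?vs)) @ R'" if "set ws \<subseteq> {p, q}" for ws
      using pump_equal_lengths[where A = B and B = A, OF len[symmetric] B A ba that refl, of R' R] ne by metis
    moreover have "set ?vs \<subseteq> {p, q}" by auto
    ultimately show ?thesis by blast
  qed
  then obtain vs where "set vs \<subseteq> {p, q}" "\<forall>ws. set ws \<subseteq> {p, q} \<longrightarrow>
      a @ concat (map A (ws @ vs)) @ R \<noteq> b @ concat (map B (ws @ vs)) @ R'"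
    by blast
  then show ?thesis
    by (intro exI[of _ "length vs"] allI exI[of _ vs]) auto
qed

section \<open>Runs through residuals\<close>

text \<open>The nonempty end makes every path extendable to a pair of its source. It also excludes
  the empty relation, to which \<open>step\<close> would allow every label.\<close>

inductive path :: "('a list \<times> 'b list) set set \<Rightarrow> ('a list \<times> 'b list) set \<Rightarrow> 'a list \<Rightarrow> 'b list
    \<Rightarrow> ('a list \<times> 'b list) set \<Rightarrow> bool" for F where
  path_Nil: "S \<in> F \<Longrightarrow> S \<noteq> {} \<Longrightarrow> path F S [] [] S"
| path_Cons: "S \<in> F \<Longrightarrow> step S a k S' \<Longrightarrow> path F S' x v S'' \<Longrightarrow> path F S (a # x) (k @ v) S''"

inductive_cases path_NilE: "path F S [] v S'"
inductive_cases path_ConsE: "path F S (a # x) v S'"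

lemma path_in: "path F S x v S' \<Longrightarrow> S \<in> F \<and> S' \<in> F \<and> S' \<noteq> {}"
  by (induction rule: path.induct) auto

lemma path_append: "path F S x v S' \<Longrightarrow> path F S' y w S'' \<Longrightarrow> path F S (x @ y) (v @ w) S''"
  by (induction rule: path.induct) (auto intro: path.intros)

lemma path_sound: "path F S x v S' \<Longrightarrow> (z, y) \<in> S' \<Longrightarrow> (x @ z, v @ y) \<in> S"
proof (induction rule: path.induct)
  case (path_Cons S a k S' x v S'')
  then show ?case unfolding step_def by fastforce
qed simp

lemma path_source_nonempty: "path F S x v S' \<Longrightarrow> S \<noteq> {}"
  using path_sound path_in by fastforce

lemma path_appendE:
  assumes "path F S (x @ y) v S''"
  obtains S' v1 v2 where "path F S x v1 S'" "path F S' y v2 S''" "v = v1 @ v2"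
proof -
  have "\<exists>S' v1 v2. path F S x v1 S' \<and> path F S' y v2 S'' \<and> v = v1 @ v2"
    using assms
  proof (induction x arbitrary: S v)
    case Nil
    then have "path F S y v S''"
      by simp
    moreover from this have "path F S [] [] S"
      using path_in path_source_nonempty by (intro path_Nil) blast+
    ultimately show ?case
      by (metis append_Nil)
  next
    case (Cons a x)
    then obtain k w S1 where *: "S \<in> F" "step S a k S1" "path F S1 (x @ y) w S''" "v = k @ w"
      by (auto elim: path_ConsE)
    then obtain S' v1 v2 where "path F S1 x v1 S'" "path F S' y v2 S''" "w = v1 @ v2"
      using Cons.IH by blast
    then show ?case
      using path_Cons[OF *(1,2)] *(4) by (metis append_assoc)
  qed
  then show thesis using that by blast
qed

lemma path_complete:
  assumes "residual_closed F" "S \<in> F" "(x @ z, y) \<in> S"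
  shows "\<exists>S' v y'. path F S x v S' \<and> (z, y') \<in> S' \<and> y = v @ y'"
  using assms(2,3)
proof (induction x arbitrary: S y)
  case Nil
  then have "path F S [] [] S"
    by (intro path_Nil) auto
  with Nil show ?case by fastforce
next
  case (Cons a x)
  then obtain S1 k y1 where *: "S1 \<in> F" "step S a k S1" "y = k @ y1" "(x @ z, y1) \<in> S1"
    using residual_closedE[OF assms(1) Cons.prems(1), of a "x @ z" y] by (metis append_Cons)
  then obtain S' v y' where "path F S1 x v S'" "(z, y') \<in> S'" "y1 = v @ y'"
    using Cons.IH by blast
  then show ?case
    using path_Cons[OF Cons.prems(1) *(2)] *(3) by (metis append_assoc)
qed

text \<open>By idempotence \<open>(p, r)\<close> lies in every power of \<open>E\<close>. A chain
  with more inner positions than states repeats some s, and each of the three parts of the chain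
  collapses to a pair of \<open>E\<close>.\<close>

lemma idempotent_relation_loop:
  assumes "E O E = E" "finite E" "(p, r) \<in> E"
  shows "\<exists>s. (p, s) \<in> E \<and> (s, s) \<in> E \<and> (s, r) \<in> E"
proof -
  have pow: "E ^^ Suc n = E" for n
    by (induction n) (use assms(1) in auto)
  define N where "N = card (Field E)"
  have "(p, r) \<in> E ^^ Suc (Suc N)"
    using pow[of "Suc N"] assms(3) by simp
  then obtain f where f: "f 0 = p" "f (Suc (Suc N)) = r" "\<And>i. i < Suc (Suc N) \<Longrightarrow> (f i, f (Suc i)) \<in> E"
    unfolding relpow_fun_conv by blast
  have E: "(f i, f j) \<in> E" if "i < j" "j \<le> Suc (Suc N)" for i j
    using that
  proof (induction j)
    case (Suc j)
    then show ?case
      using f(3)[of j] assms(1) by (cases "i = j") auto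
  qed simp
  have "f ` {1..Suc N} \<subseteq> Field E"
  proof
    fix s assume "s \<in> f ` {1..Suc N}"
    then obtain i where "s = f i" "0 < i" "i \<le> Suc (Suc N)"
      by auto
    then show "s \<in> Field E"
      using E[of 0 i] by (auto intro: FieldI2)
  qed
  moreover have "finite (Field E)"
    using assms(2) by (rule finite_Field)
  ultimately have "card (f ` {1..Suc N}) < card {1..Suc N}"
    using card_mono N_def by (metis card_atLeastAtMost diff_Suc_1 le_imp_less_Suc)
  then have "\<not> inj_on f {1..Suc N}"
    using pigeonhole by blast
  then obtain i j where "i \<in> {1..Suc N}" "j \<in> {1..Suc N}" "i < j" "f i = f j"
    unfolding inj_on_def by (metis linorder_neqE_nat)
  then show ?thesis
    using E[of 0 i] E[of i j] E[of i "Suc (Suc N)"] f(1,2) by (intro exI[of _ "f i"]) auto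
qed

lemma in_fooling_set_iff:
  "x \<in> fooling_set u2 v2 u v Z \<longleftrightarrow> (\<exists>u'\<in>{u2, v2}. \<exists>w\<in>lang_star {u, v}. \<exists>z\<in>Z. x = u' @ w @ z)"
proof
  assume "x \<in> fooling_set u2 v2 u v Z"
  then obtain x' z where 1: "x = x' @ z" "x' \<in> lang_mult {u2, v2} (lang_star {u, v})" "z \<in> Z"
    unfolding fooling_set_def by (rule lang_multE)
  from 1(2) obtain u' w where "x' = u' @ w" "u' \<in> {u2, v2}" "w \<in> lang_star {u, v}"
    by (rule lang_multE)
  then show "\<exists>u'\<in>{u2, v2}. \<exists>w\<in>lang_star {u, v}. \<exists>z\<in>Z. x = u' @ w @ z"
    using 1 by (metis append_assoc)
next
  assume "\<exists>u'\<in>{u2, v2}. \<exists>w\<in>lang_star {u, v}. \<exists>z\<in>Z. x = u' @ w @ z"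
  then obtain u' w z where "u' \<in> {u2, v2}" "w \<in> lang_star {u, v}" "z \<in> Z" "x = (u' @ w) @ z"
    by auto
  then show "x \<in> fooling_set u2 v2 u v Z"
    unfolding fooling_set_def by (simp only: lang_multI)
qed

section \<open>The transition relation of a rational function\<close>

locale rational_transducer =
  fixes t :: "('a::finite) list \<rightharpoonup> ('b::finite) list" and F :: "('a list \<times> 'b list) set set"
  assumes finite_F: "finite F" and closed_F: "residual_closed F" and graph_in_F: "graph t \<in> F"
    and suffix_closed_dom: "suffix_closed (dom t)"
begin

definition \<phi> :: "'a list \<Rightarrow> (('a list \<times> 'b list) set \<times> ('a list \<times> 'b list) set) set" where
  "\<phi> x = {(S, S'). \<exists>v. path F S x v S'}"

lemma \<phi>_append: "\<phi> (x @ y) = \<phi> x O \<phi> y"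
  unfolding \<phi>_def by (auto intro: path_append elim!: path_appendE)

lemma \<phi>_subset: "\<phi> x \<subseteq> F \<times> F"
  unfolding \<phi>_def using path_in by blast

lemma finite_\<phi>: "finite (\<phi> x)"
  by (rule finite_subset[OF \<phi>_subset]) (simp add: finite_F)

lemma finite_range_\<phi>: "finite (range \<phi>)"
  by (rule finite_subset[of _ "Pow (F \<times> F)"]) (use \<phi>_subset finite_F in auto)

lemma graph_iff: "(x, y) \<in> graph t \<longleftrightarrow> t x = Some y"
  unfolding graph_def by simp

lemma run_output: "path F (graph t) x v S \<Longrightarrow> (z, y) \<in> S \<Longrightarrow> t (x @ z) = Some (v @ y)"
  using path_sound graph_iff by blast

text \<open>Lets a prefix be exchanged for any other with the same transition relation without
  leaving the domain.\<close>

lemma dom_iff: "x @ z \<in> dom t \<longleftrightarrow> (\<exists>S. (graph t, S) \<in> \<phi> x \<and> z \<in> Domain S)"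
proof
  assume "x @ z \<in> dom t"
  then obtain y where "(x @ z, y) \<in> graph t"
    by (auto simp: graph_iff)
  then show "\<exists>S. (graph t, S) \<in> \<phi> x \<and> z \<in> Domain S"
    using path_complete[OF closed_F graph_in_F] unfolding \<phi>_def by blast
next
  assume "\<exists>S. (graph t, S) \<in> \<phi> x \<and> z \<in> Domain S"
  then show "x @ z \<in> dom t"
    unfolding \<phi>_def using run_output by blast
qed

lemma dom_cong: "\<phi> x = \<phi> y \<Longrightarrow> x @ z \<in> dom t \<longleftrightarrow> y @ z \<in> dom t"
  unfolding dom_iff by simp

lemma suffix_dom: "x @ y \<in> dom t \<Longrightarrow> y \<in> dom t"
  using suffix_closed_dom unfolding suffix_closed_def suffix_def by blast

definition accessible :: "('a list \<times> 'b list) set \<Rightarrow> bool" where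
  "accessible S \<longleftrightarrow> (\<exists>x v. path F (graph t) x v S)"

lemma accessible_functional:
  assumes "accessible S" "(z, y) \<in> S" "(z, y') \<in> S"
  shows "y = y'"
proof -
  obtain x v where "path F (graph t) x v S"
    using assms(1) unfolding accessible_def by blast
  then have "Some (v @ y) = Some (v @ y')"
    using run_output assms(2,3) by metis
  then show ?thesis by simp
qed

lemma accessible_path: "accessible S \<Longrightarrow> path F S x v S' \<Longrightarrow> accessible S'"
  unfolding accessible_def using path_append by blast

lemma loops_star:
  assumes "S \<in> F" "S \<noteq> {}" "\<And>v. v \<in> W \<Longrightarrow> \<exists>x. path F S x v S" "w \<in> lang_star W"
  shows "\<exists>x. path F S x w S"
  using assms(4)
proof (induction rule: lang_star_induct)
  case Nil
  then show ?case using path_Nil[OF assms(1,2)] by blast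
next
  case (append x y)
  then show ?case using assms(3) path_append by blast
qed

text \<open>The two loops can be run in any order, so the values of \<open>t\<close> include
  \<open>a @ w @ r\<close> for every product w of \<alpha> and \<beta>.\<close>

lemma loops_commute:
  assumes "bounded_lang ((\<lambda>x. the (t x)) ` dom t)" "accessible S" "path F S x \<alpha> S" "path F S y \<beta> S"
  shows "\<alpha> @ \<beta> = \<beta> @ \<alpha>"
proof -
  obtain p a where p: "path F (graph t) p a S"
    using assms(2) unfolding accessible_def by blast
  then have "S \<in> F" "S \<noteq> {}"
    using path_in by blast+
  then obtain z r where z: "(z, r) \<in> S" by fast
  show ?thesis
  proof (rule bounded_lang_commute[OF assms(1)])
    fix w assume "w \<in> lang_star {\<alpha>, \<beta>}"
    moreover have "\<exists>x. path F S x v S" if "v \<in> {\<alpha>, \<beta>}" for v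
      using that assms(3,4) by blast
    ultimately obtain x' where "path F S x' w S"
      using loops_star[OF \<open>S \<in> F\<close> \<open>S \<noteq> {}\<close>, of "{\<alpha>, \<beta>}" w] by blast
    then have "t (p @ x' @ z) = Some (a @ w @ r)"
      using run_output[OF path_append[OF p] z] by simp
    then show "a @ w @ r \<in> (\<lambda>x. the (t x)) ` dom t"
      by force
  qed
qed

text \<open>After reading two words of the same idempotent value \<open>E\<close>, the runs from \<open>u\<close> and \<open>v\<close> have
  each reached a state that carries loops for all words of value \<open>E\<close>; the outputs of these
  loops commute, so any difference between the two outputs could be pumped into a linear fooling
  scheme.\<close>

lemma idempotent_context_determines:
  assumes bounded: "bounded_lang ((\<lambda>x. the (t x)) ` dom t)"
    and no_fooling: "\<not> contains_linear_fooling_set t (dom t)"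
    and E: "E O E = E" "\<phi> y = E" "\<phi> y' = E" "\<phi> e = E" "\<phi> e' = E"
    and suf: "suffix u y" "suffix v y'" "length u = length v"
    and dom: "y @ e @ e' @ z \<in> dom t"
  shows "t (u @ e @ e' @ z) = t (v @ e @ e' @ z)"
proof (rule ccontr)
  assume ne: "t (u @ e @ e' @ z) \<noteq> t (v @ e @ e' @ z)"
  \<comment> \<open>The blocks end in e so that \<open>u @ e\<close> and \<open>v @ e\<close> are
    suffixes of equal length, as a scheme demands.\<close>
  define U where "U = y @ e"
  define V where "V = y' @ e"
  have phi_UV: "\<phi> U = E" "\<phi> V = E"
    unfolding U_def V_def using E by (auto simp: \<phi>_append)
  \<comment> \<open>The empty w is included and its value may differ from E; composing with E
    absorbs the difference.\<close>
  have star_E: "\<phi> w O E = E" if "w \<in> lang_star {U, V}" for w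
    using that
  proof (induction rule: lang_star_induct)
    case Nil
    have "\<phi> e = \<phi> [] O \<phi> e" by (simp flip: \<phi>_append)
    then show ?case using E by simp
  next
    case (append a b)
    then have "\<phi> (a @ b) O E = E O (\<phi> b O E)"
      using phi_UV by (auto simp: \<phi>_append O_assoc)
    then show ?case using append.IH E(1) by simp
  qed
  \<comment> \<open>Inserting w between e and e' keeps the value E of the prefix, so z still
    completes it; suffix-closedness then passes from y or y' to u or v.\<close>
  have dom_star: "u' @ e @ w @ e' @ z \<in> dom t" if "u' \<in> {u, v}" "w \<in> lang_star {U, V}" for u' w
  proof -
    have "\<phi> (y @ e @ w @ e') = E" "\<phi> (y' @ e @ w @ e') = E" "\<phi> (y @ e @ e') = E"
      using E star_E[OF that(2)] by (simp_all add: \<phi>_append)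
    then have "(y @ e @ w @ e') @ z \<in> dom t" "(y' @ e @ w @ e') @ z \<in> dom t"
      using dom dom_cong[of "y @ e @ w @ e'" "y @ e @ e'" z] dom_cong[of "y' @ e @ w @ e'" "y @ e @ e'" z]
      by simp_all
    moreover obtain p p' where "y = p @ u" "y' = p' @ v"
      using suf unfolding suffix_def by blast
    ultimately show ?thesis
      using that(1) suffix_dom by auto
  qed
  have state: "\<exists>a s A R. accessible s \<and> (\<forall>x\<in>{U, V}. path F s x (A x) s)
      \<and> (\<forall>ws. set ws \<subseteq> {U, V} \<longrightarrow> t (u' @ e @ concat ws @ e' @ z) = Some (a @ concat (map A ws) @ R))"
    if u': "u' \<in> {u, v}" for u'
  proof -
    have "u' @ e @ e' @ z \<in> dom t"
      using dom_star[OF u' Nil_in_lang_star] by simp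
    then obtain c where "(u' @ (e @ e') @ z, c) \<in> graph t"
      by (auto simp: graph_iff)
    then obtain p b c' where p: "path F (graph t) u' b p" "((e @ e') @ z, c') \<in> p"
      using path_complete[OF closed_F graph_in_F] by blast
    then obtain r b' c'' where r: "path F p (e @ e') b' r" "(z, c'') \<in> r"
      using path_complete[OF closed_F] path_in by blast
    then have "(p, r) \<in> E"
      using E unfolding \<phi>_append[symmetric] by (metis (mono_tags, lifting) \<phi>_append \<phi>_def case_prodI mem_Collect_eq)
    \<comment> \<open>The run is rerouted so that it meets a looping state s exactly between e and
      e'. The output is still that of t, whose graph is a function.\<close>
    then obtain s where s: "(p, s) \<in> E" "(s, s) \<in> E" "(s, r) \<in> E"
      using idempotent_relation_loop[OF E(1)] finite_\<phi> E(2) by blast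
    then have "(p, s) \<in> \<phi> e" "(s, r) \<in> \<phi> e'"
      using E(4,5) by simp_all
    then obtain b1 b2 where b: "path F p e b1 s" "path F s e' b2 r"
      unfolding \<phi>_def by auto
    have "\<exists>w. path F s x w s" if "x \<in> {U, V}" for x
    proof -
      have "(s, s) \<in> \<phi> x"
        using s(2) that phi_UV by auto
      then show ?thesis
        unfolding \<phi>_def by simp
    qed
    then obtain A where A: "\<And>x. x \<in> {U, V} \<Longrightarrow> path F s x (A x) s"
      by metis
    have us: "path F (graph t) (u' @ e) (b @ b1) s"
      using p(1) b(1) by (rule path_append)
    have "path F s (concat ws) (concat (map A ws)) s" if "set ws \<subseteq> {U, V}" for ws
      using that
    proof (induction ws)
      case Nil
      then show ?case using path_in[OF us] by (auto intro: path_Nil)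
    next
      case (Cons x ws)
      then show ?case using path_append[OF A[of x]] by simp
    qed
    then have "t ((u' @ e) @ concat ws @ (e' @ z)) = Some ((b @ b1) @ concat (map A ws) @ (b2 @ c''))"
      if "set ws \<subseteq> {U, V}" for ws
      using run_output[OF path_append[OF us], of "concat ws" "concat (map A ws)" s] path_sound[OF b(2) r(2)] that
      by simp
    moreover have "accessible s"
      unfolding accessible_def using us by blast
    ultimately show ?thesis
      using A by (metis append.assoc)
  qed
  obtain a s A R where A: "accessible s" "\<And>x. x \<in> {U, V} \<Longrightarrow> path F s x (A x) s"
    "\<And>ws. set ws \<subseteq> {U, V} \<Longrightarrow> t (u @ e @ concat ws @ e' @ z) = Some (a @ concat (map A ws) @ R)"
    using state[of u] by (metis insertI1)
  obtain b s' B R' where B: "accessible s'" "\<And>x. x \<in> {U, V} \<Longrightarrow> path F s' x (B x) s'"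
    "\<And>ws. set ws \<subseteq> {U, V} \<Longrightarrow> t (v @ e @ concat ws @ e' @ z) = Some (b @ concat (map B ws) @ R')"
    using state[of v] by (metis insertI1 insertI2)
  have "a @ R \<noteq> b @ R'"
    using ne A(3)[of "[]"] B(3)[of "[]"] by simp
  then obtain c where c: "\<And>n. \<exists>vs. set vs \<subseteq> {U, V} \<and> length vs \<le> c * n + c \<and>
    (\<forall>ws. set ws \<subseteq> {U, V} \<longrightarrow> length ws \<le> n \<longrightarrow>
      a @ concat (map A (ws @ vs)) @ R \<noteq> b @ concat (map B (ws @ vs)) @ R')"
    using pump_separates[of U V A B a R b R'] loops_commute[OF bounded A(1) A(2) A(2)]
      loops_commute[OF bounded B(1) B(2) B(2)] by blast
  define Z where "Z = {concat vs @ e' @ z | vs. set vs \<subseteq> {U, V}}"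
  have fooling_dom: "fooling_set (u @ e) (v @ e) U V Z \<subseteq> dom t"
  proof
    fix x assume "x \<in> fooling_set (u @ e) (v @ e) U V Z"
    then obtain u'' w z' where "u'' \<in> {u @ e, v @ e}" "w \<in> lang_star {U, V}" "z' \<in> Z" "x = u'' @ w @ z'"
      unfolding in_fooling_set_iff by blast
    moreover from this(3) obtain vs where "set vs \<subseteq> {U, V}" "z' = concat vs @ e' @ z"
      unfolding Z_def by blast
    moreover from calculation(1) obtain u' where "u' \<in> {u, v}" "u'' = u' @ e"
      by blast
    ultimately have "u' \<in> {u, v}" "w \<in> lang_star {U, V}" "set vs \<subseteq> {U, V}"
      "x = u' @ e @ (w @ concat vs) @ e' @ z"
      by simp_all
    moreover from this(2,3) have "w @ concat vs \<in> lang_star {U, V}"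
      by (intro lang_star_append) (auto simp: lang_star_def')
    ultimately show "x \<in> dom t"
      using dom_star by blast
  qed
  define L where "L = length U + length V"
  \<comment> \<open>For \<open>n \<ge> 1\<close> the number \<open>c * n + c\<close> of blocks is at
    most \<open>2 * c * n\<close>, and a block has at most L letters.\<close>
  define d where "d = 2 * c * L + length (e' @ z)"
  have "\<exists>z'\<in>Z. (1 \<le> n \<longrightarrow> length z' \<le> d * n) \<and>
      (\<forall>w\<in>lang_power_le {U, V} n. t ((u @ e) @ w @ z') \<noteq> t ((v @ e) @ w @ z'))" for n
  proof -
    obtain vs where vs: "set vs \<subseteq> {U, V}" "length vs \<le> c * n + c"
      "\<And>ws. set ws \<subseteq> {U, V} \<Longrightarrow> length ws \<le> n \<Longrightarrow>
        a @ concat (map A (ws @ vs)) @ R \<noteq> b @ concat (map B (ws @ vs)) @ R'"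
      using c[of n] by blast
    show ?thesis
    proof (intro bexI[of _ "concat vs @ e' @ z"] conjI impI ballI)
      show "concat vs @ e' @ z \<in> Z"
        unfolding Z_def using vs(1) by blast
      show "length (concat vs @ e' @ z) \<le> d * n" if "1 \<le> n"
      proof -
        have "length (concat vs) \<le> length vs * L"
          by (rule length_concat_le) (use vs(1) in \<open>auto simp: L_def dest!: subsetD\<close>)
        also have "\<dots> \<le> (c * n + c * n) * L"
          using vs(2) that by (intro mult_right_mono) (auto intro: order_trans)
        also have "\<dots> = 2 * c * L * n"
          by (simp add: algebra_simps)
        finally have "length (concat vs) \<le> 2 * c * L * n" .
        moreover have "length (e' @ z) * 1 \<le> length (e' @ z) * n"
          using that by (intro mult_left_mono) auto
        ultimately show ?thesis
          unfolding d_def add_mult_distrib length_append[of "concat vs"] by linarith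
      qed
      fix w assume "w \<in> lang_power_le {U, V} n"
      then obtain ws where ws: "w = concat ws" "set ws \<subseteq> {U, V}" "length ws \<le> n"
        unfolding lang_power_le_def by blast
      then show "t ((u @ e) @ w @ concat vs @ e' @ z) \<noteq> t ((v @ e) @ w @ concat vs @ e' @ z)"
        using A(3)[of "ws @ vs"] B(3)[of "ws @ vs"] vs(1) vs(3)[OF ws(2,3)] by simp
    qed
  qed
  moreover have "suffix (u @ e) U" "suffix (v @ e) V"
    using suf unfolding U_def V_def by (auto simp: suffix_def)
  ultimately have "linear_fooling_scheme t (u @ e) (v @ e) U V Z"
    unfolding linear_fooling_scheme_def using suf(3) fooling_dom by auto
  then show False
    using no_fooling fooling_dom unfolding contains_linear_fooling_set_def by blast
qed

end

section \<open>Exponential growth\<close>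

lemma card_le_growth:
  fixes f :: "'a::finite list \<rightharpoonup> 'c"
  assumes "inj_on (\<lambda>v. the (f (h v))) V" "\<And>v. v \<in> V \<Longrightarrow> h v \<in> X \<and> length (h v) \<le> n"
  shows "card V \<le> growth f X n"
proof -
  have "card V = card ((\<lambda>v. the (f (h v))) ` V)"
    using assms(1) by (simp add: card_image)
  also have "\<dots> \<le> card ((\<lambda>x. the (f x)) ` {x \<in> X. length x \<le> n})"
    by (rule card_mono) (use assms(2) in \<open>auto intro: finite_subset[OF _ finite_words_le]\<close>)
  finally show ?thesis
    unfolding growth_def .
qed

text \<open>Equal expansions have equal length, so both have the values on \<open>z\<close> and
  \<open>z'\<close> at the same index. The suffix must be nonempty because the expansion has no
  entry for the empty one.\<close>

lemma suffix_expansion_eqD: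
  assumes "suffix_closed (dom t)" "x @ z \<in> dom t" "y @ z' \<in> dom t" "length z = length z'" "z \<noteq> []"
    and "the (suffix_expansion t (x @ z)) = the (suffix_expansion t (y @ z'))"
  shows "t z = t z'"
proof -
  have eq: "map (\<lambda>i. the (t (drop i (x @ z)))) [0..<length (x @ z)]
      = map (\<lambda>i. the (t (drop i (y @ z')))) [0..<length (y @ z')]"
    using assms(2,3,6) unfolding suffix_expansion_def by simp
  from arg_cong[OF eq, of length] have len: "length x = length y"
    using assms(4) by simp
  from arg_cong[OF eq, of "\<lambda>l. l ! length x"] have "the (t z) = the (t z')"
  proof -
    have "0 < length z'"
      using assms(4,5) by auto
    then show ?thesis
      using \<open>_ ! length x = _ ! length x\<close> assms(4) len by simp
  qed
  moreover have "z \<in> dom t" "z' \<in> dom t"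
    using assms(1-3) unfolding suffix_closed_def suffix_def by blast+
  ultimately show ?thesis
    by auto
qed

lemma fooling_set_exponential:
  fixes t :: "('a::finite) list \<rightharpoonup> 'b list"
  assumes closed: "suffix_closed (dom t)" and "contains_linear_fooling_set t (dom t)"
  shows "grows_exponentially (growth (suffix_expansion t) (dom t))"
proof -
  obtain u2 v2 u v Z where scheme: "linear_fooling_scheme t u2 v2 u v Z"
    using assms(2) unfolding contains_linear_fooling_set_def by blast
  then have suf: "suffix u2 u" "suffix v2 v" "length u2 = length v2"
    and dom: "fooling_set u2 v2 u v Z \<subseteq> dom t"
    unfolding linear_fooling_scheme_def by blast+
  obtain c N where c: "\<And>n. \<exists>z\<in>Z. (n \<ge> N \<longrightarrow> length z \<le> c * n) \<and>
      (\<forall>w\<in>lang_power_le {u, v} n. t (u2 @ w @ z) \<noteq> t (v2 @ w @ z))"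
    using scheme unfolding linear_fooling_scheme_def by blast
  \<comment> \<open>Covers m blocks and a tail of length \<open>c * m\<close>; the summand 1 makes C
    positive.\<close>
  define C where "C = length u + length v + c + 1"
  have in_dom: "u' @ concat ws @ z \<in> dom t" if "u' \<in> {u2, v2}" "set ws \<subseteq> {u, v}" "z \<in> Z" for u' ws z
    using that dom in_fooling_set_iff[of _ u2 v2 u v Z] unfolding lang_star_def' by blast
  have star_dom: "concat ws @ z \<in> dom t" if "set ws \<subseteq> {u, v}" "z \<in> Z" for ws z
    using in_dom[of u2 ws z] that closed unfolding suffix_closed_def suffix_def by blast
  have "2 ^ m \<le> growth (suffix_expansion t) (dom t) (C * m)" if m: "m \<ge> N" for m
  proof -
    obtain z where z: "z \<in> Z" "length z \<le> c * m"
      "\<And>w. w \<in> lang_power_le {u, v} m \<Longrightarrow> t (u2 @ w @ z) \<noteq> t (v2 @ w @ z)"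
      using c[of m] m by blast
    \<comment> \<open>The empty w already separates u2 from v2. As their lengths agree, both are
      nonempty, so the compared suffixes are nonempty, and u differs from v.\<close>
    have "[] \<in> lang_power_le {u, v} m"
      unfolding lang_power_le_def by (auto intro: image_eqI[of _ _ "[]"])
    then have "u2 \<noteq> v2"
      using z(3) by blast
    then have "u2 \<noteq> []" "v2 \<noteq> []"
      using suf(3) by auto
    have "u \<noteq> v"
      using suf \<open>u2 \<noteq> v2\<close> by (metis suffix_length_suffix suffix_order.antisym le_refl)
    define V where "V = {ws. set ws \<subseteq> {u, v} \<and> length ws = m}"
    have "inj_on (\<lambda>ws. the (suffix_expansion t (concat ws @ z))) V"
    proof (rule inj_onI, rule ccontr)
      fix ws ws' assume ws: "ws \<in> V" "ws' \<in> V" "ws \<noteq> ws'"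
        and eq: "the (suffix_expansion t (concat ws @ z)) = the (suffix_expansion t (concat ws' @ z))"
      have diff: False if w: "set (p @ u # s) \<subseteq> {u, v}" "set (q @ v # s) \<subseteq> {u, v}" "length s \<le> m"
        and "the (suffix_expansion t (concat (p @ u # s) @ z)) = the (suffix_expansion t (concat (q @ v # s) @ z))"
        for p q s
      proof -
        obtain u1 v1 where uv: "u = u1 @ u2" "v = v1 @ v2"
          using suf(1,2) unfolding suffix_def by blast
        have "t (u2 @ concat s @ z) = t (v2 @ concat s @ z)"
        proof (rule suffix_expansion_eqD[OF closed])
          show "(concat p @ u1) @ u2 @ concat s @ z \<in> dom t" "(concat q @ v1) @ v2 @ concat s @ z \<in> dom t"
            using star_dom[OF w(1) z(1)] star_dom[OF w(2) z(1)] uv by simp_all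
          show "the (suffix_expansion t ((concat p @ u1) @ u2 @ concat s @ z)) =
            the (suffix_expansion t ((concat q @ v1) @ v2 @ concat s @ z))"
            using that(4) uv by simp
        qed (use suf(3) \<open>u2 \<noteq> []\<close> in auto)
        moreover have "concat s \<in> lang_power_le {u, v} m"
          using w unfolding lang_power_le_def by auto
        ultimately show False
          using z(3) by blast
      qed
      obtain p x q y s where split: "ws = p @ x # s" "ws' = q @ y # s" "x \<noteq> y"
        by (rule same_length_suffix_split[OF ws(3)]) (use ws(1,2) in \<open>auto simp: V_def\<close>)
      then have "x = u \<and> y = v \<or> x = v \<and> y = u" "length s \<le> m"
        using ws unfolding V_def by auto
      then show False
        using diff[of p s q] diff[of q s p] ws eq split unfolding V_def by auto
    qed
    moreover have "concat ws @ z \<in> dom t \<and> length (concat ws @ z) \<le> C * m" if "ws \<in> V" for ws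
    proof
      show "concat ws @ z \<in> dom t"
        using star_dom that z(1) unfolding V_def by blast
      have "length (concat ws) \<le> length ws * (length u + length v)"
        by (rule length_concat_le) (use that in \<open>auto simp: V_def dest!: subsetD\<close>)
      then have "length (concat ws @ z) \<le> m * (length u + length v) + c * m"
        using z(2) that by (simp add: V_def)
      also have "\<dots> \<le> C * m"
        unfolding C_def by (simp add: algebra_simps)
      finally show "length (concat ws @ z) \<le> C * m" .
    qed
    ultimately have "card V \<le> growth (suffix_expansion t) (dom t) (C * m)"
      by (rule card_le_growth)
    moreover have "card V = 2 ^ m"
      using card_lists_length_eq[of "{u, v}" m] \<open>u \<noteq> v\<close> unfolding V_def by (simp add: numeral_2_eq_2)
    ultimately show ?thesis by simp
  qed
  then show ?thesis
    by (intro grows_exponentiallyI[of C N]) (auto simp: C_def)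
qed

section \<open>Outputs of runs and commuting loops\<close>

lemma path_mono: "path G S x v S' \<Longrightarrow> G \<subseteq> F \<Longrightarrow> path F S x v S'"
  by (induction rule: path.induct) (auto intro: path.intros)

text \<open>Only outputs are tracked through the cut. After \<open>v1\<close> the run takes at most
  one step out of \<open>S\<close> and then stays in \<open>G - {S}\<close>, the smaller family of
  an induction on states.\<close>

lemma path_last_visit:
  assumes "path G S0 x v S'"
  shows "path (G - {S}) S0 x v S' \<or>
    (\<exists>x1 v1 v2. path G S0 x1 v1 S \<and> v = v1 @ v2 \<and>
      (v2 = [] \<or> (\<exists>a k S1 x3 v3. step S a k S1 \<and> path (G - {S}) S1 x3 v3 S' \<and> v2 = k @ v3)))"
  using assms
proof (induction rule: path.induct)
  case (path_Nil S0)
  show ?case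
  proof (cases "S0 = S")
    case True
    then have "path G S0 [] [] S"
      using path_Nil path.path_Nil by blast
    then show ?thesis by fastforce
  next
    case False
    then show ?thesis
      using path_Nil by (simp add: path.path_Nil)
  qed
next
  case (path_Cons S0 a k S1 x v S')
  from path_Cons.IH show ?case
  proof (elim disjE)
    assume *: "path (G - {S}) S1 x v S'"
    show ?thesis
    proof (cases "S0 = S")
      case True
      have "S0 \<noteq> {}"
        using path_source_nonempty[OF path.path_Cons[OF path_Cons.hyps(1-3)]] .
      then have "path G S0 [] [] S"
        using True path_Cons.hyps(1) path.path_Nil by blast
      then show ?thesis
        using * True path_Cons.hyps(2) by fastforce
    next
      case False
      then have "path (G - {S}) S0 (a # x) (k @ v) S'"
        using path_Cons.hyps(1,2) * by (intro path.path_Cons) auto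
      then show ?thesis ..
    qed
  next
    assume "\<exists>x1 v1 v2. path G S1 x1 v1 S \<and> v = v1 @ v2 \<and>
      (v2 = [] \<or> (\<exists>a k S1 x3 v3. step S a k S1 \<and> path (G - {S}) S1 x3 v3 S' \<and> v2 = k @ v3))"
    then obtain x1 v1 v2 where *: "path G S1 x1 v1 S" "v = v1 @ v2"
      "v2 = [] \<or> (\<exists>a k S1 x3 v3. step S a k S1 \<and> path (G - {S}) S1 x3 v3 S' \<and> v2 = k @ v3)"
      by blast
    have "path G S0 (a # x1) (k @ v1) S"
      using path_Cons.hyps(1,2) *(1) by (rule path.path_Cons)
    moreover have "k @ v = (k @ v1) @ v2"
      using *(2) by simp
    ultimately show ?thesis
      using *(3) by blast
  qed
qed

context rational_transducer
begin

lemma bounded_path_outputs: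
  assumes comm: "\<And>S x \<alpha> y \<beta>. accessible S \<Longrightarrow> path F S x \<alpha> S \<Longrightarrow> path F S y \<beta> S \<Longrightarrow> \<alpha> @ \<beta> = \<beta> @ \<alpha>"
    and "G \<subseteq> F" "accessible S"
  shows "bounded_lang {v. \<exists>x S'. path G S x v S'}"
  using assms(2,3)
proof (induction "card G" arbitrary: G S rule: less_induct)
  case less
  have "finite G"
    using less.prems(1) finite_F finite_subset by blast
  show ?case
  proof (cases "S \<in> G")
    case False
    then have "{v. \<exists>x S'. path G S x v S'} = {}"
      using path_in by blast
    then show ?thesis by (simp only: bounded_lang_empty)
  next
    case True
    \<comment> \<open>Loops in all of F: commutation is known for them, and the loops inside G are
      among them.\<close>
    define loops where "loops = {v. \<exists>x. path F S x v S}"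
    \<comment> \<open>Every word is a label into the empty relation, so K would not be a singleton
      there.\<close>
    define G' where "G' = {S1 \<in> G - {S}. S1 \<noteq> {}}"
    define K where "K a S1 = {k. step S a k S1}" for a S1
    define Out where "Out S1 = {v. \<exists>x S'. path (G - {S}) S1 x v S'}" for S1
    have loops: "bounded_lang loops"
      by (rule bounded_lang_commuting) (use comm[OF less.prems(2)] in \<open>auto simp: loops_def\<close>)
    have step_out: "bounded_lang (lang_mult (K a S1) (Out S1))" if S1: "S1 \<in> G'" for a S1
    proof (cases "K a S1 = {}")
      case True
      then show ?thesis by (simp add: lang_mult_def bounded_lang_empty)
    next
      case False
      then obtain k where k: "step S a k S1"
        unfolding K_def by blast
      obtain z r where z: "(z, r) \<in> S1"
        using S1 unfolding G'_def by fast
      \<comment> \<open>A pair of S1 extends both labels to outputs of the same input, and S is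
        functional.\<close>
      have "k' = k" if "step S a k' S1" for k'
        using accessible_functional[OF less.prems(2), of "a # z" "k' @ r" "k @ r"] k that z
        unfolding step_def by blast
      then have "K a S1 = {k}"
        using k unfolding K_def by blast
      have "path F S ([a] @ []) (k @ []) S1"
        unfolding append_Nil append_Cons
        by (rule path_Cons[OF _ k path_Nil]) (use S1 less.prems(1) True in \<open>auto simp: G'_def\<close>)
      then have "accessible S1"
        using accessible_path[OF less.prems(2)] by blast
      then have "bounded_lang (Out S1)"
        unfolding Out_def
        by (intro less.hyps card_Diff1_less \<open>finite G\<close> True) (use less.prems(1) in auto)
      then show ?thesis
        unfolding \<open>K a S1 = {k}\<close> by (intro bounded_lang_mult bounded_lang_singleton)
    qed
    have "finite G'"
      using \<open>finite G\<close> unfolding G'_def by simp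
    then have "bounded_lang (\<Union>a. \<Union>S1\<in>G'. lang_mult (K a S1) (Out S1))"
      by (intro bounded_lang_UN step_out) auto
    then have "bounded_lang (lang_mult loops ({[]} \<union> (\<Union>a. \<Union>S1\<in>G'. lang_mult (K a S1) (Out S1))))"
      by (intro bounded_lang_mult[OF loops] bounded_lang_Un[OF bounded_lang_singleton])
    moreover have "v \<in> lang_mult loops ({[]} \<union> (\<Union>a. \<Union>S1\<in>G'. lang_mult (K a S1) (Out S1)))"
      if v: "path G S x v S'" for x v S'
    proof -
      have "\<not> path (G - {S}) S x v S'"
        using path_in by blast
      then obtain x1 v1 v2 where *: "path G S x1 v1 S" "v = v1 @ v2"
        "v2 = [] \<or> (\<exists>a k S1 x3 v3. step S a k S1 \<and> path (G - {S}) S1 x3 v3 S' \<and> v2 = k @ v3)"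
        using path_last_visit[OF v, of S] by blast
      have "v1 \<in> loops"
        using path_mono[OF *(1) less.prems(1)] unfolding loops_def by blast
      moreover have "v2 \<in> {[]} \<union> (\<Union>a. \<Union>S1\<in>G'. lang_mult (K a S1) (Out S1))"
        using *(3)
      proof (elim disjE exE conjE)
        fix a k S1 x3 v3 assume **: "step S a k S1" "path (G - {S}) S1 x3 v3 S'" "v2 = k @ v3"
        then have "S1 \<in> G'"
          using path_in path_source_nonempty unfolding G'_def by blast
        moreover have "v2 \<in> lang_mult (K a S1) (Out S1)"
          using ** unfolding K_def Out_def by (auto intro!: lang_multI)
        ultimately show ?thesis by blast
      qed simp
      ultimately show ?thesis
        unfolding *(2) by (rule lang_multI)
    qed
    ultimately show ?thesis
      by (auto intro: bounded_lang_mono)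
  qed
qed

text \<open>The first entry of a suffix expansion is the value on the whole word, and these values
  alone are already numerous enough.\<close>

lemma noncommuting_loops_exponential:
  assumes "accessible S" "path F S x \<alpha> S" "path F S y \<beta> S" "\<alpha> @ \<beta> \<noteq> \<beta> @ \<alpha>"
  shows "grows_exponentially (growth (suffix_expansion t) (dom t))"
proof -
  obtain p a where p: "path F (graph t) p a S"
    using assms(1) unfolding accessible_def by blast
  then have S: "S \<in> F" "S \<noteq> {}"
    using path_in by blast+
  then obtain z r where z: "(z, r) \<in> S" by fast
  \<comment> \<open>Maps an output block to an input loop producing it: the lists counted consist of
    output blocks, on which concatenation is injective.\<close>
  define f where "f w = (if w = \<alpha> @ \<beta> then x @ y else y @ x)" for w
  \<comment> \<open>Loops reading nothing also write nothing and would commute. Hence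
    \<open>h ws\<close> is nonempty for nonempty ws and its expansion has a first entry.\<close>
  have "x @ y \<noteq> []"
    using assms(2-4) by (auto elim: path_NilE)
  then have f_ne: "f w \<noteq> []" for w
    unfolding f_def by auto
  have loop: "path F S (f w) w S" if "w \<in> {\<alpha> @ \<beta>, \<beta> @ \<alpha>}" for w
    using that path_append[OF assms(2,3)] path_append[OF assms(3,2)] unfolding f_def by auto
  have loops: "path F S (concat (map f ws)) (concat ws) S" if "set ws \<subseteq> {\<alpha> @ \<beta>, \<beta> @ \<alpha>}" for ws
    using that
  proof (induction ws)
    case Nil
    then show ?case using S by (auto intro: path_Nil)
  next
    case (Cons w ws)
    then show ?case using path_append[OF loop[of w]] by simp
  qed
  define h where "h ws = p @ concat (map f ws) @ z" for ws
  have t_h: "t (h ws) = Some (a @ concat ws @ r)" if "set ws \<subseteq> {\<alpha> @ \<beta>, \<beta> @ \<alpha>}" for ws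
    using run_output[OF path_append[OF p loops[OF that]] z] unfolding h_def by simp
  \<comment> \<open>The fixed ends p and z are charged to every block, which uses
    \<open>m \<ge> 1\<close>.\<close>
  define C where "C = length (x @ y) + length p + length z"
  have "2 ^ m \<le> growth (suffix_expansion t) (dom t) (C * m)" if m: "m \<ge> 1" for m
  proof -
    define V where "V = {ws. set ws \<subseteq> {\<alpha> @ \<beta>, \<beta> @ \<alpha>} \<and> length ws = m}"
    have "inj_on (\<lambda>ws. the (suffix_expansion t (h ws))) V"
    proof (rule inj_onI)
      fix ws ws' assume ws: "ws \<in> V" "ws' \<in> V"
        and eq: "the (suffix_expansion t (h ws)) = the (suffix_expansion t (h ws'))"
      have hd: "the (suffix_expansion t (h ws)) ! 0 = a @ concat ws @ r" if "ws \<in> V" for ws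
      proof -
        have "h ws \<noteq> []"
          using that f_ne m unfolding V_def h_def by (cases ws) auto
        then show ?thesis
          using t_h[of ws] that unfolding V_def suffix_expansion_def by auto
      qed
      have "concat ws = concat ws'"
        using hd[OF ws(1)] hd[OF ws(2)] eq by simp
      then show "ws = ws'"
        using card_commuting_products(1)[OF assms(4), of m] ws unfolding V_def by (auto dest: inj_onD)
    qed
    moreover have "h ws \<in> dom t \<and> length (h ws) \<le> C * m" if "ws \<in> V" for ws
    proof
      show "h ws \<in> dom t"
        using t_h that unfolding V_def by blast
      have "length (concat (map f ws)) \<le> length ws * length (x @ y)"
        by (rule length_concat_map_le) (simp add: f_def)
      then have "length (concat (map f ws)) \<le> m * length (x @ y)"
        using that unfolding V_def by simp
      moreover have "length p * 1 \<le> length p * m" "length z * 1 \<le> length z * m"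
        using m by (intro mult_left_mono; simp)+
      ultimately show "length (h ws) \<le> C * m"
        unfolding h_def C_def add_mult_distrib length_append
        by (simp only: mult.commute[of m] add_mult_distrib mult_1_right)
    qed
    ultimately have "card V \<le> growth (suffix_expansion t) (dom t) (C * m)"
      by (rule card_le_growth)
    then show ?thesis
      using card_commuting_products(2)[OF assms(4), of m] unfolding V_def by simp
  qed
  moreover have "C \<ge> 1"
    using \<open>x @ y \<noteq> []\<close> unfolding C_def by (cases x; cases y) auto
  ultimately show ?thesis
    by (intro grows_exponentiallyI)
qed

lemma unbounded_exponential:
  assumes "\<not> bounded_lang ((\<lambda>x. the (t x)) ` dom t)"
  shows "grows_exponentially (growth (suffix_expansion t) (dom t))"
proof (rule ccontr)
  assume "\<not> ?thesis"
  then have comm: "\<alpha> @ \<beta> = \<beta> @ \<alpha>" if "accessible S" "path F S x \<alpha> S" "path F S y \<beta> S" for S x \<alpha> y \<beta>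
    using noncommuting_loops_exponential that by blast
  \<comment> \<open>A path must end in a nonempty relation, so even the start state is accessible
    only if t is defined somewhere.\<close>
  have "graph t \<noteq> {}"
  proof
    assume "graph t = {}"
    then have "dom t = {}"
      by (auto simp: graph_def)
    then show False
      using assms by (simp add: bounded_lang_empty)
  qed
  then have "accessible (graph t)"
    unfolding accessible_def using path_Nil[OF graph_in_F] by blast
  define Acc where "Acc = {S \<in> F. accessible S}"
  \<comment> \<open>An accessible state has at most one final output.\<close>
  have "bounded_lang {y. ([], y) \<in> S}" if "accessible S" for S
    by (rule bounded_lang_commuting) (use accessible_functional[OF that] in blast)
  then have "bounded_lang (\<Union>S\<in>Acc. {y. ([], y) \<in> S})"
    using finite_F unfolding Acc_def by (intro bounded_lang_UN) auto
  moreover have "bounded_lang {v. \<exists>x S'. path F (graph t) x v S'}"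
    by (rule bounded_path_outputs[OF comm subset_refl \<open>accessible (graph t)\<close>])
  moreover have "(\<lambda>x. the (t x)) ` dom t \<subseteq>
    lang_mult {v. \<exists>x S'. path F (graph t) x v S'} (\<Union>S\<in>Acc. {y. ([], y) \<in> S})"
  proof clarify
    fix x y assume "t x = Some y"
    then have "(x @ [], y) \<in> graph t"
      by (simp add: graph_iff)
    then obtain S v y' where *: "path F (graph t) x v S" "([], y') \<in> S" "y = v @ y'"
      using path_complete[OF closed_F graph_in_F] by blast
    then have "S \<in> Acc"
      unfolding Acc_def accessible_def using path_in by blast
    then show "the (t x) \<in> lang_mult {v. \<exists>x S'. path F (graph t) x v S'} (\<Union>S\<in>Acc. {y. ([], y) \<in> S})"
      using * \<open>t x = Some y\<close> by (auto intro!: lang_multI)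
  qed
  ultimately show False
    using assms bounded_lang_mult bounded_lang_mono by blast
qed

end

section \<open>Polynomial growth\<close>

lemma poly_bound_prod:
  "finite A \<Longrightarrow> (\<And>a. a \<in> A \<Longrightarrow> poly_bound (f a)) \<Longrightarrow> poly_bound (\<lambda>n. \<Prod>a\<in>A. f a n)"
  by (induction rule: finite_induct) (auto intro: poly_bound_const poly_bound_mult)

text \<open>An inaccessible state may have labels of unbounded length, so only one short witness per
  element is promised.\<close>

lemma uniform_length_bound:
  fixes P :: "'x \<Rightarrow> 'c list \<Rightarrow> bool"
  assumes "finite A"
  shows "\<exists>M. \<forall>x\<in>A. \<forall>k. P x k \<longrightarrow> (\<exists>k'. P x k' \<and> length k' \<le> M)"
proof -
  define f where "f x = length (SOME k. P x k)" for x
  have "\<exists>k'. P x k' \<and> length k' \<le> sum f A" if "x \<in> A" "P x k" for x k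
  proof (intro exI conjI)
    show "P x (SOME k. P x k)"
      using that(2) by (rule someI)
    show "length (SOME k. P x k) \<le> sum f A"
      using member_le_sum[OF that(1), of f] assms unfolding f_def by simp
  qed
  then show ?thesis by blast
qed

context rational_transducer
begin

text \<open>A run may carry labels other than the short witnesses, but replacing a label by its
  witness cannot change the output of an accessible, hence functional, state.\<close>

lemma run_output_length:
  "\<exists>M. \<forall>S z y. accessible S \<longrightarrow> (z, y) \<in> S \<longrightarrow> length y \<le> M * (length z + 1)"
proof -
  obtain M0 where M0: "\<forall>S\<in>F. \<forall>k. ([], k) \<in> S \<longrightarrow> (\<exists>k'. ([], k') \<in> S \<and> length k' \<le> M0)"
    using uniform_length_bound[OF finite_F, of "\<lambda>S k. ([], k) \<in> S"] by blast
  have "finite (F \<times> (UNIV :: 'a set) \<times> F)"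
    using finite_F by simp
  from uniform_length_bound[OF this, of "\<lambda>(S, a, S') k. step S a k S'"]
  obtain M1 where M1: "\<And>S a S' k. S \<in> F \<Longrightarrow> S' \<in> F \<Longrightarrow> step S a k S' \<Longrightarrow> \<exists>k'. step S a k' S' \<and> length k' \<le> M1"
    by fastforce
  have "length y \<le> (M0 + M1) * (length z + 1)" if "accessible S" "(z, y) \<in> S" for S z y
    using that
  proof (induction z arbitrary: S y)
    case Nil
    then have "S \<in> F"
      unfolding accessible_def using path_in by blast
    then obtain k' where "([], k') \<in> S" "length k' \<le> M0"
      using M0 Nil by blast
    then show ?case
      using accessible_functional[OF Nil(1)] Nil(2) by fastforce
  next
    case (Cons a z)
    then have "S \<in> F"
      unfolding accessible_def using path_in by blast
    then obtain S' k y' where *: "S' \<in> F" "step S a k S'" "y = k @ y'" "(z, y') \<in> S'"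
      using residual_closedE[OF closed_F] Cons.prems(2) by metis
    obtain k' where k': "step S a k' S'" "length k' \<le> M1"
      using M1[OF \<open>S \<in> F\<close> *(1,2)] by blast
    then have "(a # z, k' @ y') \<in> S"
      using *(4) unfolding step_def by blast
    then have y: "y = k' @ y'"
      using accessible_functional[OF Cons.prems(1)] Cons.prems(2) by blast
    have "path F S [a] (k @ []) S'"
      by (rule path_Cons[OF \<open>S \<in> F\<close> *(2) path_Nil]) (use * in auto)
    then have "accessible S'"
      using accessible_path[OF Cons.prems(1)] by blast
    then have "length y' \<le> (M0 + M1) * (length z + 1)"
      using Cons.IH *(4) by blast
    then show ?case
      using k'(2) unfolding y by simp
  qed
  then show ?thesis by blast
qed

section \<open>Context functions\<close>

definition context_fun :: "'a list \<Rightarrow> 'a list \<Rightarrow> 'b list option" where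
  "context_fun z = (\<lambda>w. t (w @ z))"

text \<open>A prefix leads to some accessible S, so \<open>context_fun z\<close> is determined by
  the outputs of the accessible states on z. Behind a fixed output leading to S such an output
  becomes a value of \<open>t\<close> of linear length, and boundedness leaves polynomially
  many.\<close>

lemma poly_bound_context_fun:
  assumes bounded: "bounded_lang ((\<lambda>x. the (t x)) ` dom t)"
  shows "poly_bound (\<lambda>n. card (context_fun ` {z. length z \<le> n}))"
proof -
  define Acc where "Acc = {S \<in> F. accessible S}"
  have "finite Acc"
    unfolding Acc_def using finite_F by simp
  obtain M where M: "\<And>S z y. accessible S \<Longrightarrow> (z, y) \<in> S \<Longrightarrow> length y \<le> M * (length z + 1)"
    using run_output_length by blast
  define val where "val z = (\<lambda>S\<in>Acc. {y. (z, y) \<in> S})" for z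
  define V where "V S n = {y. (\<exists>z. (z, y) \<in> S) \<and> length y \<le> M * n + M}" for S :: "('a list \<times> 'b list) set" and n
  have finite_V: "finite (V S n)" for S n
    unfolding V_def by (auto intro: finite_subset[OF _ finite_words_le])
  have V_poly: "poly_bound (\<lambda>n. card (V S n))" if S: "S \<in> Acc" for S
  proof -
    obtain x v where xv: "path F (graph t) x v S"
      using S unfolding Acc_def accessible_def by blast
    have "card (V S n) \<le> card {w \<in> (\<lambda>x. the (t x)) ` dom t. length w \<le> M * n + (M + length v)}" for n
    proof (rule card_inj_on_le[of "\<lambda>y. v @ y"])
      show "(\<lambda>y. v @ y) ` V S n \<subseteq> {w \<in> (\<lambda>x. the (t x)) ` dom t. length w \<le> M * n + (M + length v)}"
      proof (rule image_subsetI)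
        fix y assume "y \<in> V S n"
        then obtain z where "(z, y) \<in> S" "length y \<le> M * n + M"
          unfolding V_def by blast
        moreover from this(1) have "t (x @ z) = Some (v @ y)"
          by (rule run_output[OF xv])
        ultimately show "v @ y \<in> {w \<in> (\<lambda>x. the (t x)) ` dom t. length w \<le> M * n + (M + length v)}"
          by force
      qed
      show "finite {w \<in> (\<lambda>x. the (t x)) ` dom t. length w \<le> M * n + (M + length v)}"
        by (auto intro: finite_subset[OF _ finite_words_le])
    qed (simp add: inj_on_def)
    then show ?thesis
      by (rule poly_bound_mono[OF poly_bound_comp_linear[OF poly_bound_bounded_lang[OF bounded]]])
  qed
  \<comment> \<open>The empty set stands for a state without output on z; all other output sets are
    singletons. This is the summand 1 in the product below.\<close>
  define B where "B n = (\<lambda>S. insert {} ((\<lambda>y. {y}) ` V S n))" for n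
  have finite_B: "finite (B n S)" for n S
    unfolding B_def using finite_V by simp
  have val_B: "val ` {z. length z \<le> n} \<subseteq> Pi\<^sub>E Acc (B n)" for n
  proof clarify
    fix z :: "'a list" assume z: "length z \<le> n"
    have "{y. (z, y) \<in> S} \<in> B n S" if "S \<in> Acc" for S
    proof (cases "{y. (z, y) \<in> S} = {}")
      case True
      then show ?thesis unfolding B_def by blast
    next
      case False
      then obtain y where y: "(z, y) \<in> S" by blast
      have "accessible S"
        using that unfolding Acc_def by blast
      then have "{y. (z, y) \<in> S} = {y}" "length y \<le> M * (length z + 1)"
        using accessible_functional y M by blast+
      moreover have "M * (length z + 1) \<le> M * n + M"
        using z by simp
      ultimately have "y \<in> V S n"
        using y order_trans unfolding V_def by blast
      then show ?thesis
        unfolding B_def \<open>{y. (z, y) \<in> S} = {y}\<close> by blast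
    qed
    then show "val z \<in> Pi\<^sub>E Acc (B n)"
      unfolding val_def by auto
  qed
  have card_val: "card (context_fun ` {z. length z \<le> n}) \<le> (\<Prod>S\<in>Acc. card (V S n) + 1)" for n
  proof -
    have det: "context_fun z = context_fun z'" if "val z = val z'" for z z'
    proof -
      have *: "t (x @ z') = Some y" if "val z = val z'" "t (x @ z) = Some y" for x y z z'
      proof -
        obtain S v y' where S: "path F (graph t) x v S" "(z, y') \<in> S" "y = v @ y'"
          using path_complete[OF closed_F graph_in_F] \<open>t (x @ z) = Some y\<close> graph_iff by metis
        then have "S \<in> Acc"
          unfolding Acc_def accessible_def using path_in by blast
        then have "{y. (z, y) \<in> S} = {y. (z', y) \<in> S}"
          using fun_cong[OF \<open>val z = val z'\<close>, of S] unfolding val_def by simp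
        then show ?thesis
          using run_output[OF S(1)] S(2,3) by blast
      qed
      show ?thesis
        unfolding context_fun_def
      proof
        fix w show "t (w @ z) = t (w @ z')"
          using *[OF that, of w] *[OF that[symmetric], of w] by (cases "t (w @ z)"; cases "t (w @ z')") auto
      qed
    qed
    have fin: "finite (Pi\<^sub>E Acc (B n))"
      using \<open>finite Acc\<close> finite_B by (intro finite_PiE)
    have "card (context_fun ` {z. length z \<le> n}) \<le> card (val ` {z. length z \<le> n})"
      by (rule card_image_le_of_determines(2)[OF finite_subset[OF val_B fin]]) (rule det)
    also have "\<dots> \<le> card (Pi\<^sub>E Acc (B n))"
      by (rule card_mono[OF fin val_B])
    also have "\<dots> = (\<Prod>S\<in>Acc. card (B n S))"
      by (rule card_PiE[OF \<open>finite Acc\<close>])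
    also have "\<dots> \<le> (\<Prod>S\<in>Acc. card (V S n) + 1)"
    proof (rule prod_mono)
      fix S
      have "card (B n S) \<le> Suc (card ((\<lambda>y. {y}) ` V S n))"
        unfolding B_def by (rule card_insert_le_m1) auto
      also have "\<dots> \<le> card (V S n) + 1"
        using card_image_le[OF finite_V, of "\<lambda>y. {y}" S n] by simp
      finally show "0 \<le> card (B n S) \<and> card (B n S) \<le> card (V S n) + 1" by simp
    qed
    finally show ?thesis .
  qed
  have "poly_bound (\<lambda>n. \<Prod>S\<in>Acc. card (V S n) + 1)"
    using \<open>finite Acc\<close> V_poly by (intro poly_bound_prod poly_bound_add poly_bound_const)
  then show ?thesis
    using card_val by (rule poly_bound_mono)
qed

text \<open>The second component is all that factors to the left of \<open>x\<close> can observe of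
  \<open>x @ z\<close>; it makes expansions composable from right to left.\<close>

definition expansion :: "'a list \<Rightarrow> 'a list \<Rightarrow> 'b list option list \<times> ('a list \<Rightarrow> 'b list option)" where
  "expansion x z = (map (\<lambda>i. t (drop i x @ z)) [0..<length x], context_fun (x @ z))"

definition expansions :: "'a list set \<Rightarrow> nat \<Rightarrow> 'a list \<Rightarrow> ('b list option list \<times> ('a list \<Rightarrow> 'b list option)) set" where
  "expansions X n z = (\<lambda>x. expansion x z) ` {x \<in> X. length x \<le> n \<and> x @ z \<in> dom t}"

text \<open>One f must serve all contexts, since in a product the right factor joins the context of
  the left one. Bounding \<open>length z\<close> keeps the number of context functions
  polynomial.\<close>

definition few_expansions :: "'a list set \<Rightarrow> bool" where
  "few_expansions X \<longleftrightarrow> (\<exists>f. poly_bound f \<and> (\<forall>n z. length z \<le> n \<longrightarrow> card (expansions X n z) \<le> f n))"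

lemma finite_expansions: "finite (expansions X n z)"
  unfolding expansions_def by (intro finite_imageI finite_subset[OF _ finite_words_le[of n]]) auto

lemma few_expansionsI:
  "poly_bound f \<Longrightarrow> (\<And>n z. length z \<le> n \<Longrightarrow> card (expansions X n z) \<le> f n) \<Longrightarrow> few_expansions X"
  unfolding few_expansions_def by blast

lemma few_expansionsE:
  assumes "few_expansions X"
  obtains f where "poly_bound f" "\<And>n z. length z \<le> n \<Longrightarrow> card (expansions X n z) \<le> f n"
  using assms unfolding few_expansions_def by blast

lemma few_expansions_mono:
  assumes "few_expansions X" "Y \<subseteq> X"
  shows "few_expansions Y"
proof -
  obtain f where f: "poly_bound f" "\<And>n z. length z \<le> n \<Longrightarrow> card (expansions X n z) \<le> f n"
    using few_expansionsE[OF assms(1)] by blast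
  have "card (expansions Y n z) \<le> card (expansions X n z)" for n z
    by (rule card_mono[OF finite_expansions]) (use assms(2) in \<open>auto simp: expansions_def\<close>)
  then show ?thesis
    using f(2) by (intro few_expansionsI[OF f(1)]) (meson order_trans)
qed

lemma few_expansions_finite:
  assumes "finite X"
  shows "few_expansions X"
proof (rule few_expansionsI[OF poly_bound_const[of "card X"]])
  fix n and z :: "'a list"
  have "card (expansions X n z) \<le> card {x \<in> X. length x \<le> n \<and> x @ z \<in> dom t}"
    unfolding expansions_def using assms by (intro card_image_le) auto
  also have "\<dots> \<le> card X"
    using assms by (intro card_mono) auto
  finally show "card (expansions X n z) \<le> card X" .
qed

lemma few_expansions_Un:
  assumes "few_expansions X" "few_expansions Y"
  shows "few_expansions (X \<union> Y)"
proof -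
  obtain f where f: "poly_bound f" "\<And>n z. length z \<le> n \<Longrightarrow> card (expansions X n z) \<le> f n"
    using few_expansionsE[OF assms(1)] by blast
  obtain g where g: "poly_bound g" "\<And>n z. length z \<le> n \<Longrightarrow> card (expansions Y n z) \<le> g n"
    using few_expansionsE[OF assms(2)] by blast
  show ?thesis
  proof (rule few_expansionsI[OF poly_bound_add[OF f(1) g(1)]])
    fix n and z :: "'a list" assume z: "length z \<le> n"
    have "expansions (X \<union> Y) n z = expansions X n z \<union> expansions Y n z"
      unfolding expansions_def by blast
    then have "card (expansions (X \<union> Y) n z) \<le> card (expansions X n z) + card (expansions Y n z)"
      by (simp add: card_Un_le)
    then show "card (expansions (X \<union> Y) n z) \<le> f n + g n"
      using f(2)[OF z] g(2)[OF z] by linarith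
  qed
qed

lemma context_fun_append: "context_fun (x @ z) = (\<lambda>w. context_fun z (w @ x))"
  unfolding context_fun_def by simp

lemma expansion_cong:
  assumes "context_fun z = context_fun z'"
  shows "expansion x z = expansion x z'" "x @ z \<in> dom t \<longleftrightarrow> x @ z' \<in> dom t"
proof -
  have "t (w @ z) = t (w @ z')" for w
    using fun_cong[OF assms, of w] unfolding context_fun_def .
  then show "expansion x z = expansion x z'" "x @ z \<in> dom t \<longleftrightarrow> x @ z' \<in> dom t"
    using assms unfolding expansion_def context_fun_append by auto
qed

lemma expansion_append:
  "expansion (x @ y) z = (fst (expansion x (y @ z)) @ fst (expansion y z), snd (expansion x (y @ z)))"
  unfolding expansion_def by (auto intro!: nth_equalityI simp: nth_append)

lemma snd_expansion: "snd (expansion x z) = context_fun (x @ z)"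
  unfolding expansion_def by simp

text \<open>The expansion j of the right factor is counted first. A representative of j has the same
  context function, on which alone the expansion of the left factor depends; so the left factor is
  counted over one context of length at most 2 n for each j.\<close>

lemma few_expansions_mult:
  assumes "few_expansions X" "few_expansions Y"
  shows "few_expansions (lang_mult X Y)"
proof -
  obtain f where f: "poly_bound f" "\<And>n z. length z \<le> n \<Longrightarrow> card (expansions X n z) \<le> f n"
    using few_expansionsE[OF assms(1)] by blast
  obtain g where g: "poly_bound g" "\<And>n z. length z \<le> n \<Longrightarrow> card (expansions Y n z) \<le> g n"
    using few_expansionsE[OF assms(2)] by blast
  have "poly_bound (\<lambda>n. g n * f (2 * n + 0))"
    by (intro poly_bound_mult g(1) poly_bound_comp_linear f(1))
  then show ?thesis
  proof (rule few_expansionsI)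
    fix n and z :: "'a list" assume z: "length z \<le> n"
    define rep where "rep j = (SOME y. y \<in> Y \<and> length y \<le> n \<and> y @ z \<in> dom t \<and> expansion y z = j)" for j
    have rep: "rep j \<in> Y \<and> length (rep j) \<le> n \<and> rep j @ z \<in> dom t \<and> expansion (rep j) z = j"
      if "j \<in> expansions Y n z" for j
      unfolding rep_def by (rule someI_ex) (use that in \<open>auto simp: expansions_def\<close>)
    define G where "G j = (\<lambda>s. (fst s @ fst j, snd s)) ` expansions X (2 * n) (rep j @ z)" for j
    show "card (expansions (lang_mult X Y) n z) \<le> g n * f (2 * n + 0)"
    proof (rule card_subset_UN_le[OF finite_expansions, where F = G])
      show "expansions (lang_mult X Y) n z \<subseteq> (\<Union>j\<in>expansions Y n z. G j)"
      proof
        fix s assume "s \<in> expansions (lang_mult X Y) n z"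
        then obtain w where w: "w \<in> lang_mult X Y" "length w \<le> n" "w @ z \<in> dom t" "s = expansion w z"
          unfolding expansions_def by blast
        then obtain x y where xy: "w = x @ y" "x \<in> X" "y \<in> Y"
          by (auto elim: lang_multE)
        define j where "j = expansion y z"
        have j: "j \<in> expansions Y n z"
          using w xy suffix_dom[of x "y @ z"] unfolding expansions_def j_def by auto
        have "context_fun (y @ z) = context_fun (rep j @ z)"
          using rep[OF j] snd_expansion unfolding j_def by metis
        note cong = expansion_cong[OF this, of x]
        have "expansion x (rep j @ z) \<in> expansions X (2 * n) (rep j @ z)"
          using w xy cong(2) unfolding expansions_def by auto
        moreover have "s = (fst (expansion x (rep j @ z)) @ fst j, snd (expansion x (rep j @ z)))"
          unfolding w(4) xy(1) expansion_append j_def cong(1)[symmetric, unfolded j_def] ..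
        ultimately show "s \<in> (\<Union>j\<in>expansions Y n z. G j)"
          using j unfolding G_def by blast
      qed
      show "finite (G j)" for j
        unfolding G_def by (intro finite_imageI finite_expansions)
      show "card (expansions Y n z) \<le> g n"
        using g(2)[OF z] .
      show "card (G j) \<le> f (2 * n + 0)" if "j \<in> expansions Y n z" for j
      proof -
        have "card (G j) \<le> card (expansions X (2 * n) (rep j @ z))"
          unfolding G_def by (rule card_image_le[OF finite_expansions])
        also have "\<dots> \<le> f (2 * n + 0)"
          using f(2)[of "rep j @ z" "2 * n"] rep[OF that] z by simp
        finally show ?thesis .
      qed
    qed
  qed
qed

lemma few_expansions_star:
  assumes bounded: "bounded_lang ((\<lambda>x. the (t x)) ` dom t)"
    and no_fooling: "\<not> contains_linear_fooling_set t (dom t)"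
    and X: "few_expansions X" "\<phi> ` X \<subseteq> {E}" "E O E = E"
  shows "few_expansions (lang_star X)"
proof -
  define XX where "XX = lang_mult X X"
  have XX: "few_expansions XX"
    unfolding XX_def by (intro few_expansions_mult X(1))
  \<comment> \<open>The left part ranges over all words of value E, since apart from its length
    nothing else about it enters the count.\<close>
  define W where "W = lang_mult {y. \<phi> y = E} XX"
  obtain f where f: "poly_bound f" "\<And>n z. length z \<le> n \<Longrightarrow> card (expansions XX n z) \<le> f n"
    using few_expansionsE[OF XX] by blast
  define h where "h n = card (context_fun ` {z. length z \<le> n})" for n
  have "poly_bound h"
    unfolding h_def using poly_bound_context_fun[OF bounded] .
  then have "poly_bound (\<lambda>n. f n * ((1 * n + 1) * h (2 * n + 0)))"
    by (intro poly_bound_mult f(1) poly_bound_comp_linear poly_bound_linear)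
  then have "few_expansions W"
  proof (rule few_expansionsI)
    fix n and z :: "'a list" assume z: "length z \<le> n"
    define T where "T = {(y, x). \<phi> y = E \<and> x \<in> XX \<and> length (y @ x) \<le> n \<and> y @ x @ z \<in> dom t}"
    \<comment> \<open>The middle datum accounts for the entries inside y; the context function of
      the whole word is the second component of its expansion and is counted separately.\<close>
    define g where "g = (\<lambda>(y, x). (expansion x z, length y, context_fun (y @ x @ z)))"
    have g_T: "g ` T \<subseteq> expansions XX n z \<times> {..n} \<times> context_fun ` {z. length z \<le> 2 * n}"
    proof (rule image_subsetI)
      fix p assume "p \<in> T"
      then obtain y x where p: "p = (y, x)" and *: "\<phi> y = E" "x \<in> XX" "length (y @ x) \<le> n" "y @ x @ z \<in> dom t"
        unfolding T_def by auto
      have "x @ z \<in> dom t"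
        using *(4) by (rule suffix_dom)
      moreover have "length (y @ x @ z) \<le> 2 * n"
        using *(3) z by simp
      ultimately show "g p \<in> expansions XX n z \<times> {..n} \<times> context_fun ` {z. length z \<le> 2 * n}"
        using * unfolding p g_def expansions_def by auto
    qed
    have fin: "finite (expansions XX n z \<times> {..n} \<times> context_fun ` {z. length z \<le> 2 * n})"
      by (intro finite_cartesian_product finite_expansions finite_imageI finite_words_le) simp
    have det: "(\<lambda>(y, x). expansion (y @ x) z) p = (\<lambda>(y, x). expansion (y @ x) z) p'"
      if p: "p \<in> T" "p' \<in> T" "g p = g p'" for p p'
    proof -
      obtain y x y' x' where [simp]: "p = (y, x)" "p' = (y', x')"
        by fastforce
      have y: "\<phi> y = E" "\<phi> y' = E" "length y = length y'" "y @ x @ z \<in> dom t"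
        and eq: "expansion x z = expansion x' z" "context_fun (y @ x @ z) = context_fun (y' @ x' @ z)"
        using p unfolding T_def g_def by auto
      obtain e e' where x: "x = e @ e'" "\<phi> e = E" "\<phi> e' = E"
        using p(1) X(2) unfolding T_def XX_def by (auto elim!: lang_multE)
      have "context_fun (x @ z) = context_fun (x' @ z)"
        using eq(1) snd_expansion by metis
      note cong = expansion_cong(1)[OF this, of y']
      \<comment> \<open>As y and y' have equal length, so do their suffixes at index i, and x splits
        into two blocks of value E.\<close>
      have "t (drop i y @ x @ z) = t (drop i y' @ x @ z)" for i
        using idempotent_context_determines[OF bounded no_fooling X(3) y(1,2) x(2,3), of "drop i y" "drop i y'" z]
          y(3,4) x(1) by (simp add: suffix_drop)
      then have "fst (expansion y (x @ z)) = fst (expansion y' (x @ z))"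
        using y(3) unfolding expansion_def by simp
      \<comment> \<open>Under y', x may be exchanged for x' because their expansions agree, and with
        them their context functions.\<close>
      then have "fst (expansion y (x @ z)) = fst (expansion y' (x' @ z))"
        using cong by simp
      then show ?thesis
        using eq by (simp add: expansion_append snd_expansion)
    qed
    have "expansions W n z \<subseteq> (\<lambda>(y, x). expansion (y @ x) z) ` T"
    proof
      fix s assume "s \<in> expansions W n z"
      then obtain w where w: "w \<in> W" "length w \<le> n" "w @ z \<in> dom t" "s = expansion w z"
        unfolding expansions_def by blast
      then obtain y x where "w = y @ x" "\<phi> y = E" "x \<in> XX"
        unfolding W_def by (auto elim: lang_multE)
      then show "s \<in> (\<lambda>(y, x). expansion (y @ x) z) ` T"
        using w unfolding T_def by (intro image_eqI[of _ _ "(y, x)"]) auto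
    qed
    then have "card (expansions W n z) \<le> card ((\<lambda>(y, x). expansion (y @ x) z) ` T)"
      using card_image_le_of_determines(1)[OF finite_subset[OF g_T fin] det] by (rule card_mono[rotated])
    also have "\<dots> \<le> card (g ` T)"
      by (rule card_image_le_of_determines(2)[OF finite_subset[OF g_T fin] det])
    also have "\<dots> \<le> card (expansions XX n z \<times> {..n} \<times> context_fun ` {z. length z \<le> 2 * n})"
      by (rule card_mono[OF fin g_T])
    also have "\<dots> = card (expansions XX n z) * ((1 * n + 1) * h (2 * n + 0))"
      by (simp add: card_cartesian_product h_def)
    also have "\<dots> \<le> f n * ((1 * n + 1) * h (2 * n + 0))"
      using f(2)[OF z] by (rule mult_right_mono) simp
    finally show "card (expansions W n z) \<le> f n * ((1 * n + 1) * h (2 * n + 0))" .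
  qed
  \<comment> \<open>The last two factors form the context block, and by idempotence everything
    before them has value E; words of fewer than three factors make up the other sets.\<close>
  moreover have "lang_star X \<subseteq> {[]} \<union> X \<union> XX \<union> W"
  proof
    fix w assume "w \<in> lang_star X"
    then show "w \<in> {[]} \<union> X \<union> XX \<union> W"
    proof (induction rule: lang_star_induct)
      case (append x y)
      have "\<phi> x = E"
        using append.hyps(1) X(2) by blast
      from append.IH consider "y = []" | "y \<in> X" | "y \<in> XX" | y1 y2 where "y = y1 @ y2" "\<phi> y1 = E" "y2 \<in> XX"
        unfolding W_def by (auto elim: lang_multE)
      then show ?case
      proof cases
        case 1
        then show ?thesis using append.hyps(1) by simp
      next
        case 2
        then have "x @ y \<in> XX"
          unfolding XX_def by (intro lang_multI append.hyps(1))
        then show ?thesis by blast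
      next
        case 3
        then have "x @ y \<in> W"
          unfolding W_def using \<open>\<phi> x = E\<close> by (intro lang_multI) auto
        then show ?thesis by blast
      next
        case 4
        then have "(x @ y1) @ y2 \<in> W"
          unfolding W_def using \<open>\<phi> x = E\<close> X(3) by (intro lang_multI) (auto simp: \<phi>_append)
        then show ?thesis using 4 by simp
      qed
    qed simp
  qed
  ultimately show ?thesis
    using few_expansions_mono[OF few_expansions_Un[OF few_expansions_Un[OF few_expansions_Un[OF
      few_expansions_finite X(1)] XX]]] by (metis finite.emptyI finite.insertI)
qed

lemma polynomial_growth:
  assumes bounded: "bounded_lang ((\<lambda>x. the (t x)) ` dom t)"
    and no_fooling: "\<not> contains_linear_fooling_set t (dom t)"
  shows "grows_polynomially (growth (suffix_expansion t) (dom t))"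
proof -
  interpret idempotent_star_closed "(O)" \<phi> few_expansions
  proof
    show "(A O B) O C = A O (B O C)" for A B C :: "(('a list \<times> 'b list) set) rel"
      by (rule O_assoc)
    show "few_expansions (lang_star X)" if "few_expansions X" "\<phi> ` X \<subseteq> {E}" "E O E = E" for X E
      using that by (rule few_expansions_star[OF bounded no_fooling])
  qed (fact \<phi>_append finite_range_\<phi> few_expansions_mono few_expansions_finite few_expansions_Un
      few_expansions_mult)+
  obtain f where f: "poly_bound f" "\<And>n z. length z \<le> n \<Longrightarrow> card (expansions UNIV n z) \<le> f n"
    using few_expansionsE[OF I_UNIV] by blast
  have "growth (suffix_expansion t) (dom t) n \<le> f n" for n
  proof -
    \<comment> \<open>With the empty context, the side condition in \<open>expansions\<close> is
      membership in the domain, so the universal language covers exactly the words counted by the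
      growth.\<close>
    have "the (suffix_expansion t x) = map the (fst (expansion x []))" if "x \<in> dom t" for x
      using that unfolding suffix_expansion_def expansion_def by simp
    then have "(\<lambda>x. the (suffix_expansion t x)) ` {x \<in> dom t. length x \<le> n}
        \<subseteq> (\<lambda>s. map the (fst s)) ` expansions UNIV n []"
      unfolding expansions_def by auto
    then have "growth (suffix_expansion t) (dom t) n \<le> card ((\<lambda>s. map the (fst s)) ` expansions UNIV n [])"
      unfolding growth_def by (intro card_mono finite_imageI finite_expansions)
    also have "\<dots> \<le> card (expansions UNIV n [])"
      by (rule card_image_le[OF finite_expansions])
    finally show ?thesis
      using f(2)[of "[]" n] by simp
  qed
  then have "poly_bound (growth (suffix_expansion t) (dom t))"
    by (rule poly_bound_mono[OF f(1)])
  then show ?thesis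
    unfolding poly_bound_def using grows_polynomiallyI by blast
qed

end

theorem theorem6:
  fixes t :: "('a::finite) list \<rightharpoonup> ('b::finite) list"
  assumes "rational_fun t"
    and "suffix_closed (dom t)"
  shows "(\<not> contains_linear_fooling_set t (dom t) \<and> bounded_lang ((\<lambda>x. the (t x)) ` dom t)
            \<longrightarrow> grows_polynomially (growth (suffix_expansion t) (dom t)))
       \<and> (\<not> (\<not> contains_linear_fooling_set t (dom t) \<and> bounded_lang ((\<lambda>x. the (t x)) ` dom t))
            \<longrightarrow> grows_exponentially (growth (suffix_expansion t) (dom t)))"
proof -
  obtain F where "finite F" "residual_closed F" "graph t \<in> F"
    using finite_residual_family assms(1) unfolding rational_fun_def by blast
  then interpret rational_transducer t F
    using assms(2) by unfold_locales
  show ?thesis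
    using polynomial_growth unbounded_exponential fooling_set_exponential[OF assms(2)] by blast
qed

end
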